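(* Let $3\leq d=d(n)\leq \ln n/\ln\ln n$. There is an absolute constant $C>0$, sequences of positive integers $t_1=t_1(n)$, $t_2=t_2(n)$, $q=q(n)$, and a Cayley sum-graph $\Gamma=\Gamma(n)$ of the group $\mathbb{Z}_2^{t_1}\times\mathbb{Z}_q^{t_2}$ such that, for every positive integer $n$: \begin{itemize} \item the generating set of $\Gamma$ has size at most $C\,n^{1-2/d}d^2(\ln n)^{2+4/d}$; \item $\Gamma$ contains every graph with $n$ vertices and maximum degree at most $d$ as a subgraph. \end{itemize}
   Context: For an abelian group $(H,+)$ and a subset $U\subseteq H$ (called the generating set), the Cayley sum-graph of $H$ with respect to $U$ has vertex set $H$, with $h_1,h_2$ adjacent iff $h_1+h_2\in U$ (loops may occur). $\mathbb{Z}_q$ denotes the cyclic group of order $q$; $\ln$ is the natural logarithm. *)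

theory Defs
  imports
    Complex_Main
    "HOL-Algebra.Product_Groups"
    "Graph_Theory.Graph_Theory"
begin

text \<open>
  Undirected graphs are rendered, as in \<^theory>\<open>Graph_Theory.Digraph\<close>, as symmetric digraphs
  without parallel arcs.  A finite simple graph is a \<^locale>\<open>pair_graph\<close>; every edge
  contributes exactly one arc leaving each of its endpoints, so \<^const>\<open>out_degree\<close> is the
  degree.
\<close>

text \<open>
  HOL-Algebra writes all groups multiplicatively, so the product below is the sum of the
  two group elements.  An element \<open>h\<close> with \<open>h + h \<in> U\<close> carries a loop.
  The intended use is with \<^locale>\<open>comm_group\<close> and \<open>U \<subseteq> carrier H\<close>.
\<close>

definition cayley_sum_graph :: "('a, 'b) monoid_scheme \<Rightarrow> 'a set \<Rightarrow> 'a pair_pre_digraph" where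
  "cayley_sum_graph H U =
     \<lparr> pverts = carrier H,
       parcs = {(h1, h2). h1 \<in> carrier H \<and> h2 \<in> carrier H \<and> h1 \<otimes>\<^bsub>H\<^esub> h2 \<in> U} \<rparr>"

text \<open>Containment as a (not necessarily induced) subgraph, up to isomorphism.\<close>

definition contains_subgraph :: "'a pair_pre_digraph \<Rightarrow> 'b pair_pre_digraph \<Rightarrow> bool" where
  "contains_subgraph G F \<longleftrightarrow>
     (\<exists>K :: 'a pair_pre_digraph. subgraph (with_proj K) (with_proj G) \<and>
        digraph_iso (with_proj F) (with_proj K))"

text \<open>
  The group $\mathbb{Z}_2^{t_1} \times \mathbb{Z}_q^{t_2}$; note that
  \<open>integer_mod_group 0\<close> is the infinite cyclic group, so \<open>q > 0\<close> must be required separately.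
\<close>

definition Z2_Zq_group :: "nat \<Rightarrow> nat \<Rightarrow> nat \<Rightarrow> ((nat \<Rightarrow> int) \<times> (nat \<Rightarrow> int)) monoid" where
  "Z2_Zq_group t1 t2 q =
     product_group {..<t1} (\<lambda>_. integer_mod_group 2) \<times>\<times>
     product_group {..<t2} (\<lambda>_. integer_mod_group q)"

lemma comm_group_integer_mod_group: "comm_group (integer_mod_group n)"
  by (rule group.group_comm_groupI) (auto simp: add.commute)

lemma comm_group_product_group:
  assumes "\<And>i. i \<in> I \<Longrightarrow> comm_group (G i)"
  shows "comm_group (product_group I G)"
proof (rule group.group_comm_groupI)
  show "group (product_group I G)"
    using assms by (simp add: comm_group_def)
next
  fix x y assume xy: "x \<in> carrier (product_group I G)" "y \<in> carrier (product_group I G)"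
  have "x i \<otimes>\<^bsub>G i\<^esub> y i = y i \<otimes>\<^bsub>G i\<^esub> x i" if "i \<in> I" for i
    using that xy comm_groupE(4)[OF assms[OF that]] by (simp add: PiE_iff)
  then show "x \<otimes>\<^bsub>product_group I G\<^esub> y = y \<otimes>\<^bsub>product_group I G\<^esub> x"
    by (simp cong: restrict_cong)
qed

lemma comm_group_Z2_Zq_group: "comm_group (Z2_Zq_group t1 t2 q)"
proof -
  interpret A: comm_group "product_group {..<t1} (\<lambda>_. integer_mod_group 2)"
    by (intro comm_group_product_group comm_group_integer_mod_group)
  interpret B: comm_group "product_group {..<t2} (\<lambda>_. integer_mod_group q)"
    by (intro comm_group_product_group comm_group_integer_mod_group)
  have "group (Z2_Zq_group t1 t2 q)"
    unfolding Z2_Zq_group_def by (rule DirProd_group) unfold_locales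
  then show ?thesis
    by (rule group.group_comm_groupI)
      (auto simp: Z2_Zq_group_def DirProd_def A.m_comm B.m_comm simp del: carrier_product_group mult_product_group)
qed

lemma card_Z2_Zq_group:
  assumes "q > 0"
  shows "card (carrier (Z2_Zq_group t1 t2 q)) = 2 ^ t1 * q ^ t2"
  using assms
  by (simp add: Z2_Zq_group_def DirProd_def card_cartesian_product carrier_integer_mod_group card_PiE)

lemma pair_sym_digraph_cayley_sum_graph:
  assumes "comm_group H"
  shows "pair_sym_digraph (cayley_sum_graph H U)"
proof -
  interpret comm_group H by fact
  show ?thesis
    by unfold_locales (auto simp: cayley_sum_graph_def symmetric_def sym_def m_comm)
qed

lemma contains_subgraph_iff:
  assumes "pair_wf_digraph G" "pair_wf_digraph F"
  shows "contains_subgraph G F \<longleftrightarrow>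
    (\<exists>f. inj_on f (pverts F) \<and> f ` pverts F \<subseteq> pverts G \<and>
       (\<forall>(u, v) \<in> parcs F. (f u, f v) \<in> parcs G))"
proof
  assume "contains_subgraph G F"
  then obtain K h where K: "subgraph (with_proj K) (with_proj G)"
    and h: "pre_digraph.digraph_isomorphism (with_proj F) h" "with_proj K = app_iso h (with_proj F)"
    unfolding contains_subgraph_def digraph_iso_def by blast
  have ht: "iso_tail h = fst" "iso_head h = snd"
    using arg_cong[OF h(2), of tail] arg_cong[OF h(2), of head] by (auto simp: app_iso_def)
  have V: "pverts K = iso_verts h ` pverts F" and A: "parcs K = iso_arcs h ` parcs F"
    using arg_cong[OF h(2), of verts] arg_cong[OF h(2), of arcs] by (auto simp: app_iso_def)
  have "iso_arcs h (u, v) = (iso_verts h u, iso_verts h v)" if "(u, v) \<in> parcs F" for u v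
    using h(1) that unfolding pre_digraph.digraph_isomorphism_def ht
    by (metis fst_conv prod.collapse snd_conv with_proj_simps(2,4,5))
  then show "\<exists>f. inj_on f (pverts F) \<and> f ` pverts F \<subseteq> pverts G \<and>
       (\<forall>(u, v) \<in> parcs F. (f u, f v) \<in> parcs G)"
    using K h(1) V A unfolding subgraph_def pre_digraph.digraph_isomorphism_def
    by (intro exI[of _ "iso_verts h"]) (auto simp: image_subset_iff split: prod.splits)
next
  assume "\<exists>f. inj_on f (pverts F) \<and> f ` pverts F \<subseteq> pverts G \<and>
       (\<forall>(u, v) \<in> parcs F. (f u, f v) \<in> parcs G)"
  then obtain f where f: "inj_on f (pverts F)" "f ` pverts F \<subseteq> pverts G"
    "\<forall>(u, v) \<in> parcs F. (f u, f v) \<in> parcs G" by (elim exE conjE)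
  interpret F: pair_wf_digraph F by fact
  define K where "K = \<lparr> pverts = f ` pverts F, parcs = map_prod f f ` parcs F \<rparr>"
  define h where "h = \<lparr> iso_verts = f, iso_arcs = map_prod f f, iso_head = snd, iso_tail = fst \<rparr>"
  have "pair_wf_digraph K"
    by unfold_locales (auto simp: K_def intro: imageI[OF F.in_arcsD1] imageI[OF F.in_arcsD2])
  then have "subgraph (with_proj K) (with_proj G)"
    using f(2,3) assms(1) unfolding subgraph_def compatible_def wf_digraph_wp_iff
    by (auto simp: K_def)
  moreover have "inj_on (map_prod f f) (parcs F)"
  proof (rule inj_on_subset)
    show "inj_on (map_prod f f) (pverts F \<times> pverts F)"
      using f(1) by (intro map_prod_inj_on)
    show "parcs F \<subseteq> pverts F \<times> pverts F"
      using F.in_arcsD1 F.in_arcsD2 by auto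
  qed
  then have "pre_digraph.digraph_isomorphism (with_proj F) h"
    using f(1) assms(2) unfolding pre_digraph.digraph_isomorphism_def wf_digraph_wp_iff
    by (auto simp: h_def)
  moreover have "with_proj K = app_iso h (with_proj F)"
    by (simp add: with_proj_def app_iso_def K_def h_def)
  ultimately show "contains_subgraph G F"
    unfolding contains_subgraph_def digraph_iso_def by blast
qed

end

theory Submission
  imports Defs
begin

text \<open>
  An even subgraph can be oriented with equal in- and out-degrees, and every finite graph is a
  union of cycles and a forest.  Letting each cycle edge spend two slots at its tail and each
  forest edge one slot at either end, a vertex of degree at most \<open>d\<close> spends at most \<open>d\<close> slots, so
  there are self-maps \<open>g\<^sub>i\<close> (\<open>i < d\<close>) of the vertex set such that every edge joins \<open>v\<close> to \<open>g\<^sub>i v\<close>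
  for two different \<open>i\<close>.

  For each \<open>i\<close>, vertices carry random symbols, and the \<open>i\<close>-th block of the embedding lists the
  symbols seen along \<open>v, g\<^sub>i v, g\<^sub>i\<^sup>2 v, \<dots>\<close>, at \<open>t\<close> cells filled cyclically.  Then \<open>v\<close> and \<open>g\<^sub>i v\<close>
  differ in at most one cell of block \<open>i\<close>, so in \<open>\<int>\<^sub>2\<^sup>N\<close> the sum along an edge vanishes outside one
  cell in two of the \<open>d\<close> blocks.  There are about \<open>(t d)\<^sup>2 4\<^sup>-\<^sup>2\<^sup>t 2\<^sup>N\<close> such elements.  The moment of order
  \<open>2 t d\<close> of the fibre sizes shows that some choice of symbols makes all fibres as small as the
  average up to a constant, as long as that average is at least \<open>(ln n)\<^sup>2\<close>; a few extra coordinates,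
  unrestricted in the generating set, separate the points of a fibre.  Hence \<open>\<int>\<^sub>2\<^sup>N\<close> alone suffices and
  the factor \<open>\<int>\<^sub>q\<close> is taken trivial.
\<close>

section \<open>Orbits of a self-map of a finite set\<close>

locale finite_self_map =
  fixes V :: "'a set" and g :: "'a \<Rightarrow> 'a" and t :: nat
  assumes fin: "finite V" and closed: "v \<in> V \<Longrightarrow> g v \<in> V" and t_pos: "0 < t"
begin

text \<open>A point that the orbit of \<open>v\<close> visits infinitely often. The predicate under
  \<open>SOME\<close> is the same for \<open>v\<close> and \<open>g v\<close>, so all points of an
  orbit share one base, whichever recurrent point gets chosen.\<close>

definition base :: "'a \<Rightarrow> 'a" where
  "base v = (SOME u. \<forall>a. \<exists>j\<ge>a. (g ^^ j) v = u)"

definition depth :: "'a \<Rightarrow> nat" where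
  "depth v = (LEAST j. (g ^^ j) v = base v)"

text \<open>
  Along an orbit the depth drops by one at each step, except when the orbit passes the base point
  of its cycle.  At that seam labels may repeat, which is why windows of length \<open>2 t\<close> are
  needed to see \<open>t\<close> labels.
\<close>

definition label :: "'a \<Rightarrow> nat" where
  "label v = depth v mod t"

text \<open>The vertex whose random symbol is shown in cell \<open>c\<close>. The fallback
  \<open>base v\<close> lies on the orbit and does not change from \<open>v\<close> to
  \<open>g v\<close>, so \<open>source_step\<close> and \<open>source_in_orbit\<close> hold for
  absent labels too.\<close>

definition source :: "nat \<Rightarrow> 'a \<Rightarrow> 'a" where
  "source c v = (if \<exists>j. label ((g ^^ j) v) = c
     then (g ^^ (LEAST j. label ((g ^^ j) v) = c)) v else base v)"

lemma funpow_closed: "v \<in> V \<Longrightarrow> (g ^^ j) v \<in> V"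
  by (induction j) (auto intro: closed)

lemma base_recurrent:
  assumes "v \<in> V"
  shows "\<exists>j\<ge>a. (g ^^ j) v = base v"
proof -
  have "finite (range (\<lambda>j. (g ^^ j) v))"
    using fin funpow_closed[OF assms] by (auto intro: finite_subset)
  then obtain i where i: "infinite {j \<in> UNIV. (g ^^ j) v = (g ^^ i) v}"
    using pigeonhole_infinite[of "UNIV :: nat set" "\<lambda>j. (g ^^ j) v"] by auto
  have "\<exists>u. \<forall>a. \<exists>j\<ge>a. (g ^^ j) v = u"
    using i by (intro exI[of _ "(g ^^ i) v"]) (auto simp: infinite_nat_iff_unbounded_le)
  then have "\<forall>a. \<exists>j\<ge>a. (g ^^ j) v = base v"
    unfolding base_def by (rule someI_ex)
  then show ?thesis by blast
qed

lemma base_step [simp]: "base (g v) = base v"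
proof -
  have "(\<forall>a. \<exists>j\<ge>a. (g ^^ j) (g v) = u) \<longleftrightarrow> (\<forall>a. \<exists>j\<ge>a. (g ^^ j) v = u)" for u
  proof
    assume *: "\<forall>a. \<exists>j\<ge>a. (g ^^ j) (g v) = u"
    show "\<forall>a. \<exists>j\<ge>a. (g ^^ j) v = u"
    proof
      fix a
      obtain j where "j \<ge> a" "(g ^^ j) (g v) = u" using * by blast
      then show "\<exists>j\<ge>a. (g ^^ j) v = u"
        by (intro exI[of _ "Suc j"]) (simp add: funpow_Suc_right del: funpow.simps)
    qed
  next
    assume *: "\<forall>a. \<exists>j\<ge>a. (g ^^ j) v = u"
    show "\<forall>a. \<exists>j\<ge>a. (g ^^ j) (g v) = u"
    proof
      fix a
      obtain j where "j \<ge> Suc a" "(g ^^ j) v = u" using * by blast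
      then show "\<exists>j\<ge>a. (g ^^ j) (g v) = u"
        by (cases j) (auto simp: funpow_Suc_right simp del: funpow.simps)
    qed
  qed
  then show ?thesis by (simp add: base_def)
qed

lemma base_funpow [simp]: "base ((g ^^ j) v) = base v"
  by (induction j) auto

lemma funpow_depth:
  assumes "v \<in> V" shows "(g ^^ depth v) v = base v"
  unfolding depth_def using base_recurrent[OF assms] by (metis (mono_tags, lifting) LeastI)

lemma depth_funpow:
  assumes "v \<in> V" "i \<le> depth v"
  shows "depth ((g ^^ i) v) = depth v - i"
  unfolding depth_def[of "(g ^^ i) v"]
proof (rule Least_equality)
  show "(g ^^ (depth v - i)) ((g ^^ i) v) = base ((g ^^ i) v)"
    using assms funpow_depth[OF assms(1)] by (simp flip: funpow_add comp_apply[of "g ^^ _"])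
next
  fix j assume "(g ^^ j) ((g ^^ i) v) = base ((g ^^ i) v)"
  then have "(g ^^ (j + i)) v = base v" by (simp add: funpow_add)
  then have "depth v \<le> j + i" unfolding depth_def by (rule Least_le)
  then show "depth v - i \<le> j" by simp
qed

text \<open>If \<open>v\<close> itself does not carry the label \<open>c\<close>, the search for
  \<open>c\<close> from \<open>v\<close> and from \<open>g v\<close> stops at the same point. Hence
  only the cell \<open>label v\<close> can change between \<open>v\<close> and
  \<open>g v\<close>.\<close>

lemma source_step:
  assumes "c \<noteq> label v"
  shows "source c (g v) = source c v"
proof -
  have eq: "(g ^^ j) (g v) = (g ^^ Suc j) v" for j
    by (simp add: funpow_Suc_right del: funpow.simps)
  have ex: "(\<exists>j. label ((g ^^ j) v) = c) \<longleftrightarrow> (\<exists>j. label ((g ^^ Suc j) v) = c)"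
    using assms by (metis (no_types, lifting) not0_implies_Suc funpow_0)
  show ?thesis
  proof (cases "\<exists>j. label ((g ^^ j) v) = c")
    case True
    have "(LEAST j. label ((g ^^ j) v) = c) = Suc (LEAST j. label ((g ^^ Suc j) v) = c)"
      using True assms Least_Suc[of "\<lambda>j. label ((g ^^ j) v) = c"] by (metis funpow_0)
    with True ex show ?thesis
      unfolding source_def eq by simp
  next
    case False
    with ex show ?thesis unfolding source_def eq by auto
  qed
qed

lemma source_in_orbit:
  assumes "v \<in> V" shows "\<exists>j. source c v = (g ^^ j) v"
  unfolding source_def using base_recurrent[OF assms] by metis

lemma source_early:
  assumes "label ((g ^^ j) v) = c"
  shows "\<exists>i\<le>j. source c v = (g ^^ i) v"
proof -
  have "(LEAST j. label ((g ^^ j) v) = c) \<le> j" using assms by (rule Least_le)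
  then show ?thesis using assms unfolding source_def by auto
qed

text \<open>The orbit descends to its base and, one step later, begins a second descent to it.
  Either one of the two descents has at least \<open>a\<close> points, or the base recurs so soon
  that the first \<open>2 * a - 1\<close> points exhaust the orbit.\<close>

lemma orbit_run_or_short:
  assumes v: "v \<in> V" and a: "0 < a"
  shows "(\<exists>j<a. a \<le> Suc (depth ((g ^^ j) v))) \<or> (\<forall>j. \<exists>i<2 * a - 1. (g ^^ j) v = (g ^^ i) v)"
proof -
  define D where "D = depth v"
  define u where "u = (g ^^ Suc D) v"
  have u: "u \<in> V" unfolding u_def by (rule funpow_closed[OF v])
  consider "a \<le> Suc D" | "Suc D < a" "a \<le> Suc (depth u)" | "Suc D < a" "Suc (depth u) < a"
    by linarith
  then show ?thesis
  proof cases
    case 1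
    then show ?thesis using a unfolding D_def by (intro disjI1 exI[of _ 0]) simp
  next
    case 2
    then show ?thesis unfolding u_def by (intro disjI1) blast
  next
    case 3
    \<comment> \<open>\<open>D\<close> and \<open>N\<close> are the times of the first two visits to
      the base.\<close>
    define N where "N = Suc D + depth u"
    have N: "N < 2 * a - 1" "D < N" using 3 unfolding N_def by auto
    have "(g ^^ N) v = (g ^^ depth u) u"
      unfolding N_def u_def by (metis add.commute comp_apply funpow_add)
    also have "\<dots> = (g ^^ D) v"
      using funpow_depth[OF u] funpow_depth[OF v] unfolding u_def D_def
      by (simp del: funpow.simps)
    finally have per: "(g ^^ N) v = (g ^^ D) v" .
    have "\<exists>i<N. (g ^^ j) v = (g ^^ i) v" for j
    proof (induction j)
      case 0
      then show ?case using N by (intro exI[of _ 0]) simp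
    next
      case (Suc j)
      then obtain i where i: "i < N" "(g ^^ j) v = (g ^^ i) v" by blast
      then have *: "(g ^^ Suc j) v = (g ^^ Suc i) v" by simp
      show ?case
      proof (cases "Suc i = N")
        case True
        then show ?thesis using * per N by metis
      next
        case False
        then show ?thesis using * i(1) by (metis Suc_lessI)
      qed
    qed
    then show ?thesis using N(1) by (meson less_trans)
  qed
qed

text \<open>Consecutive depths in a descent differ by less than \<open>t\<close> as long as there
  are at most \<open>t\<close> of them, so their residues are distinct. A run of \<open>a\<close>
  points that starts before time \<open>a\<close> is over before time
  \<open>2 * a - 1\<close>.\<close>

lemma orbit_labels_or_short:
  assumes v: "v \<in> V" and a: "0 < a" "a \<le> t"
  shows "a \<le> card ((\<lambda>j. label ((g ^^ j) v)) ` {..<2 * a - 1}) \<or>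
    (\<forall>j. \<exists>i<2 * a - 1. (g ^^ j) v = (g ^^ i) v)"
  using orbit_run_or_short[OF v a(1)]
proof (elim disjE exE conjE)
  fix j assume j: "j < a" "a \<le> Suc (depth ((g ^^ j) v))"
  define D where "D = depth ((g ^^ j) v)"
  have lab: "label ((g ^^ (i + j)) v) = (D - i) mod t" if "i < a" for i
    using depth_funpow[OF funpow_closed[OF v], of i j] that j
    unfolding label_def D_def by (simp add: funpow_add)
  have "inj_on (\<lambda>i. (D - i) mod t) {..<a}"
  proof (rule linorder_inj_onI')
    fix i k assume ik: "i \<in> {..<a}" "k \<in> {..<a}" "i < k"
    show "(D - i) mod t \<noteq> (D - k) mod t"
    proof
      assume "(D - i) mod t = (D - k) mod t"
      then have "t dvd (D - i) - (D - k)" by (rule mod_eq_dvd_iff_nat[THEN iffD1, rotated]) (use ik in auto)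
      then have "t dvd k - i" using ik j by (simp add: D_def)
      then have "t \<le> k - i" using ik by (intro dvd_imp_le) auto
      then show False using ik a by auto
    qed
  qed
  then have "a = card ((\<lambda>i. (D - i) mod t) ` {..<a})" by (simp add: card_image)
  also have "\<dots> \<le> card ((\<lambda>j. label ((g ^^ j) v)) ` {..<2 * a - 1})"
  proof (rule card_mono)
    show "(\<lambda>i. (D - i) mod t) ` {..<a} \<subseteq> (\<lambda>j. label ((g ^^ j) v)) ` {..<2 * a - 1}"
    proof (rule image_subsetI)
      fix i assume "i \<in> {..<a}"
      then show "(D - i) mod t \<in> (\<lambda>j. label ((g ^^ j) v)) ` {..<2 * a - 1}"
        using lab[of i] j(1) by (intro image_eqI[of _ _ "i + j"]) auto
    qed
  qed simp
  finally show ?thesis by blast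
qed blast

text \<open>With \<open>a = t\<close>, the window either shows all \<open>t\<close> labels or
  contains the whole orbit.\<close>

lemma source_in_window:
  assumes v: "v \<in> V" and c: "c < t"
  shows "\<exists>j<2 * t. source c v = (g ^^ j) v"
  using orbit_labels_or_short[OF v t_pos order_refl]
proof
  let ?L = "(\<lambda>j. label ((g ^^ j) v)) ` {..<2 * t - 1}"
  assume "t \<le> card ?L"
  moreover have sub: "?L \<subseteq> {..<t}" using t_pos by (auto simp: label_def)
  ultimately have "?L = {..<t}" by (intro card_seteq) auto
  then obtain j where "j < 2 * t - 1" "label ((g ^^ j) v) = c"
    using c by (metis (no_types, lifting) imageE lessThan_iff)
  then show ?thesis using source_early[of j v c] by (meson less_imp_diff_less le_less_trans less_le_trans diff_le_self)
next
  assume "\<forall>j. \<exists>i<2 * t - 1. (g ^^ j) v = (g ^^ i) v"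
  then show ?thesis using source_in_orbit[OF v, of c]
    by (metis diff_le_self less_le_trans)
qed

text \<open>A label seen in the prefix has its source at that point or earlier, hence outside
  \<open>Z\<close>. Half of the prefix, rounded up, bounds the number of distinct labels from below;
  otherwise the prefix is the whole orbit and all \<open>t\<close> cells are fresh. The lost factor
  2 is made up by the two bits of a cell.\<close>

lemma avoiding_prefix_fresh_sources:
  assumes v: "v \<in> V" and h: "h \<le> 2 * t" and avoid: "\<And>j. j < h \<Longrightarrow> (g ^^ j) v \<notin> Z"
  shows "h \<le> 2 * card {c. c < t \<and> source c v \<notin> Z}"
proof (cases "h = 0")
  case False
  define a where "a = (h + 1) div 2"
  have a: "0 < a" "a \<le> t" "2 * a - 1 \<le> h" "h \<le> 2 * a" using False h by (auto simp: a_def)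
  have "a \<le> card {c. c < t \<and> source c v \<notin> Z}"
    using orbit_labels_or_short[OF v a(1,2)]
  proof
    assume "a \<le> card ((\<lambda>j. label ((g ^^ j) v)) ` {..<2 * a - 1})"
    also have "\<dots> \<le> card {c. c < t \<and> source c v \<notin> Z}"
    proof (rule card_mono)
      show "(\<lambda>j. label ((g ^^ j) v)) ` {..<2 * a - 1} \<subseteq> {c. c < t \<and> source c v \<notin> Z}"
      proof (rule image_subsetI)
        fix j assume j: "j \<in> {..<2 * a - 1}"
        obtain i where "i \<le> j" "source (label ((g ^^ j) v)) v = (g ^^ i) v"
          using source_early[OF refl] by blast
        then show "label ((g ^^ j) v) \<in> {c. c < t \<and> source c v \<notin> Z}"
          using avoid[of i] j a(3) t_pos by (auto simp: label_def)
      qed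
    qed simp
    finally show ?thesis .
  next
    assume *: "\<forall>j. \<exists>i<2 * a - 1. (g ^^ j) v = (g ^^ i) v"
    have "source c v \<notin> Z" for c
      using source_in_orbit[OF v, of c] * avoid a(3) by (metis less_le_trans)
    then show ?thesis using a by simp
  qed
  then show ?thesis using a by linarith
qed simp

lemma card_funpow_vimage:
  assumes deg: "\<And>u. u \<in> V \<Longrightarrow> card {v \<in> V. g v = u} \<le> \<Delta>" and Z: "Z \<subseteq> V"
  shows "card {v \<in> V. (g ^^ j) v \<in> Z} \<le> card Z * \<Delta> ^ j"
proof (induction j)
  case 0
  then show ?case using Z fin by (auto intro!: card_mono finite_subset[OF Z])
next
  case (Suc j)
  let ?Y = "{v \<in> V. (g ^^ j) v \<in> Z}"
  have "{v \<in> V. (g ^^ Suc j) v \<in> Z} = (\<Union>u\<in>?Y. {v \<in> V. g v = u})"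
    by (auto simp: funpow_Suc_right closed simp del: funpow.simps)
  then have "card {v \<in> V. (g ^^ Suc j) v \<in> Z} \<le> (\<Sum>u\<in>?Y. card {v \<in> V. g v = u})"
    using fin by (simp add: card_UN_le)
  also have "\<dots> \<le> (\<Sum>u\<in>?Y. \<Delta>)" by (intro sum_mono deg) simp
  also have "\<dots> \<le> card Z * \<Delta> ^ j * \<Delta>" using Suc.IH by simp
  finally show ?case by (simp add: algebra_simps)
qed

end

section \<open>Expected overlap of a random vertex with a small set\<close>

lemma Suc_le_two_power_pred: "3 \<le> d \<Longrightarrow> Suc d \<le> 2 ^ (d - 1)"
proof (induction d rule: dec_induct)
  case (step d)
  then have "Suc (Suc d) \<le> 2 * 2 ^ (d - 1)" by linarith
  also have "\<dots> = 2 ^ (Suc d - 1)" using step(1) by (metis Suc_diff_1 diff_Suc_1 gr0I not_numeral_le_zero power_Suc)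
  finally show ?case .
qed simp

text \<open>Charge \<open>v\<close> to the first time \<open>j\<close> at which one of its
  \<open>d\<close> orbits meets the points near \<open>W\<close>. Until then every block is fresh,
  so the weight is at most \<open>2^(-d*j)\<close>, while at most \<open>(d+1)^j\<close> vertices
  reach a given point in \<open>j\<close> steps of one map. Since \<open>d + 1 <= 2^(d-1)\<close>,
  the charges form a geometric series of ratio 1/2. Vertices never charged give the main
  term.\<close>

lemma sum_fresh_weight_le:
  fixes V :: "'a set" and g :: "nat \<Rightarrow> 'a \<Rightarrow> 'a" and d t r :: nat
  defines "src \<equiv> \<lambda>i. finite_self_map.source (g i) t"
  assumes fin: "finite V" and closed: "\<And>i v. i < d \<Longrightarrow> v \<in> V \<Longrightarrow> g i v \<in> V"
    and deg: "\<And>i u. i < d \<Longrightarrow> u \<in> V \<Longrightarrow> card {v \<in> V. g i v = u} \<le> Suc d"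
    and d: "3 \<le> d" and W: "W \<subseteq> V" "card W \<le> r"
  shows "(\<Sum>v\<in>V. (1/2) ^ (\<Sum>i<d. 2 * card {c. c < t \<and> src i c v \<notin> src i c ` W}))
    \<le> real (card V) / 4 ^ (t * d) + 4 * real d * real r * real t"
proof (cases "t = 0")
  case True
  then show ?thesis by simp
next
  case False
  then have t: "0 < t" by simp
  have G: "finite_self_map V (g i) t" if "i < d" for i
    using fin closed[OF that] t by unfold_locales auto
  \<comment> \<open>The windows of the vertices of \<open>W\<close>, long enough to contain all
    their sources.\<close>
  define Z where "Z i = (\<lambda>(w, j). (g i ^^ j) w) ` (W \<times> {..<2 * t})" for i
  have finW: "finite W" using fin W(1) finite_subset by blast
  have Z_sub: "Z i \<subseteq> V" if "i < d" for i
    using finite_self_map.funpow_closed[OF G[OF that]] W(1) by (auto simp: Z_def)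
  have card_Z: "card (Z i) \<le> 2 * r * t" for i
  proof -
    have "card (Z i) \<le> card (W \<times> {..<2 * t})"
      unfolding Z_def by (rule card_image_le) (simp add: finW)
    also have "\<dots> = card W * (2 * t)" by (simp add: card_cartesian_product)
    also have "\<dots> \<le> r * (2 * t)" using W(2) by (rule mult_right_mono) simp
    finally show ?thesis by simp
  qed
  have src_Z: "src i c w \<in> Z i" if "i < d" "w \<in> W" "c < t" for i c w
    using finite_self_map.source_in_window[OF G[OF that(1)] _ that(3), of w] that(2) W(1)
    unfolding Z_def src_def by fastforce
  define fresh where "fresh v = (\<Sum>i<d. 2 * card {c. c < t \<and> src i c v \<notin> src i c ` W})" for v
  define hit where "hit i j v \<longleftrightarrow> (g i ^^ j) v \<in> Z i" for i j v
  have fresh_ge: "d * h \<le> fresh v"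
    if v: "v \<in> V" and h: "h \<le> 2 * t" and avoid: "\<And>i j. i < d \<Longrightarrow> j < h \<Longrightarrow> \<not> hit i j v" for v h
  proof -
    have "h \<le> 2 * card {c. c < t \<and> src i c v \<notin> src i c ` W}" if i: "i < d" for i
    proof -
      have "h \<le> 2 * card {c. c < t \<and> src i c v \<notin> Z i}"
        using finite_self_map.avoiding_prefix_fresh_sources[OF G[OF i] v h, of "Z i"] avoid[OF i]
        unfolding hit_def src_def by blast
      also have "card {c. c < t \<and> src i c v \<notin> Z i} \<le> card {c. c < t \<and> src i c v \<notin> src i c ` W}"
        using src_Z[OF i] by (intro card_mono) auto
      finally show ?thesis by simp
    qed
    then have "(\<Sum>i<d. h) \<le> fresh v" unfolding fresh_def by (intro sum_mono) auto
    then show ?thesis by simp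
  qed
  \<comment> \<open>Summing over all possible hits instead of the first one only increases the
    bound, and allows the sum over \<open>v\<close> to be taken inside.\<close>
  have pointwise: "(1/2::real) ^ fresh v \<le> 1 / 4 ^ (t * d) +
      (\<Sum>i<d. \<Sum>j<2 * t. of_bool (hit i j v) * (1/2) ^ (d * j))" if v: "v \<in> V" for v
  proof (cases "\<exists>j<2 * t. \<exists>i<d. hit i j v")
    case False
    then have "d * (2 * t) \<le> fresh v" by (intro fresh_ge[OF v]) auto
    then have "(1/2::real) ^ fresh v \<le> (1/2) ^ (d * (2 * t))" by (intro power_decreasing) auto
    also have "d * (2 * t) = 2 * (t * d)" by simp
    also have "(1/2::real) ^ \<dots> = 1 / 4 ^ (t * d)" by (simp only: power_mult) (simp add: power_divide)
    finally show ?thesis by (smt (verit) of_bool_def mult_nonneg_nonneg sum_nonneg zero_le_power divide_nonneg_nonneg)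
  next
    case True
    define j where "j = (LEAST j. j < 2 * t \<and> (\<exists>i<d. hit i j v))"
    have "j < 2 * t \<and> (\<exists>i<d. hit i j v)"
      unfolding j_def by (rule LeastI_ex) (use True in blast)
    then obtain i where j: "j < 2 * t" and i: "i < d" "hit i j v" by blast
    have "d * j \<le> fresh v"
    proof (rule fresh_ge[OF v])
      fix i' j' assume "i' < d" "j' < j"
      then show "\<not> hit i' j' v"
        using not_less_Least[of j' "\<lambda>j. j < 2 * t \<and> (\<exists>i<d. hit i j v)"] j
        unfolding j_def[symmetric] by auto
    qed (use j in simp)
    then have "(1/2::real) ^ fresh v \<le> of_bool (hit i j v) * (1/2) ^ (d * j)"
      using i(2) by (simp add: power_decreasing)
    also have "\<dots> \<le> (\<Sum>j<2 * t. of_bool (hit i j v) * (1/2) ^ (d * j))"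
      using j by (intro member_le_sum) auto
    also have "\<dots> \<le> (\<Sum>i<d. \<Sum>j<2 * t. of_bool (hit i j v) * (1/2) ^ (d * j))"
      using i(1) by (intro member_le_sum[where i = i and f = "\<lambda>i. \<Sum>j<2 * t. of_bool (hit i j v) * (1/2) ^ (d * j)"] sum_nonneg) auto
    finally show ?thesis by (simp add: add_increasing)
  qed
  have "(\<Sum>v\<in>V. (1/2::real) ^ fresh v) \<le> (\<Sum>v\<in>V. 1 / 4 ^ (t * d) +
      (\<Sum>i<d. \<Sum>j<2 * t. of_bool (hit i j v) * (1/2) ^ (d * j)))"
    by (intro sum_mono pointwise)
  also have "\<dots> = real (card V) / 4 ^ (t * d) +
      (\<Sum>i<d. \<Sum>j<2 * t. (\<Sum>v\<in>V. of_bool (hit i j v)) * (1/2) ^ (d * j))"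
    by (simp add: sum.distrib sum_distrib_right sum.swap[of _ V])
  also have "\<dots> \<le> real (card V) / 4 ^ (t * d) + (\<Sum>i<d. \<Sum>j<2 * t. real (2 * r * t) * (1/2) ^ j)"
  proof (intro add_left_mono sum_mono)
    fix i j assume i: "i \<in> {..<d}" 
    have "(\<Sum>v\<in>V. of_bool (hit i j v)) = real (card {v \<in> V. (g i ^^ j) v \<in> Z i})"
      using fin by (simp add: hit_def sum.If_cases of_bool_def Collect_conj_eq Int_commute)
    also have "\<dots> \<le> real (card (Z i) * Suc d ^ j)"
      using finite_self_map.card_funpow_vimage[OF G deg Z_sub] i by (intro of_nat_mono) auto
    also have "\<dots> \<le> real (2 * r * t * (2 ^ (d - 1)) ^ j)"
      by (intro of_nat_mono mult_mono power_mono card_Z Suc_le_two_power_pred d) auto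
    finally have "(\<Sum>v\<in>V. of_bool (hit i j v)) * (1/2) ^ (d * j)
        \<le> real (2 * r * t * (2 ^ (d - 1)) ^ j) * (1/2) ^ (d * j)"
      by (rule mult_right_mono) simp
    also have "\<dots> = real (2 * r * t) * ((2 ^ (d - 1)) * (1/2) ^ d) ^ j"
      by (simp add: power_mult power_mult_distrib)
    also have "2 ^ (d - 1) * (1/2::real) ^ d = 1/2"
      using d by (cases d) (auto simp: power_divide)
    finally show "(\<Sum>v\<in>V. of_bool (hit i j v)) * (1/2) ^ (d * j) \<le> real (2 * r * t) * (1/2) ^ j" .
  qed
  also have "(\<Sum>i<d. \<Sum>j<2 * t. real (2 * r * t) * (1/2) ^ j)
      = real d * (real (2 * r * t) * (\<Sum>j<2 * t. (1/2) ^ j))"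
    by (simp add: sum_distrib_left)
  also have "\<dots> \<le> real d * (real (2 * r * t) * 2)"
    by (intro mult_left_mono) (auto simp: geometric_sum)
  finally show ?thesis unfolding fresh_def by (simp add: algebra_simps)
qed

section \<open>Balanced fibres\<close>

lemma card_PiE_prescribed:
  assumes "finite I" "S \<subseteq> I" "\<And>p. p \<in> S \<Longrightarrow> y p \<in> B"
  shows "card {x \<in> I \<rightarrow>\<^sub>E B. \<forall>p\<in>S. x p = y p} = card B ^ (card I - card S)"
proof -
  have "{x \<in> I \<rightarrow>\<^sub>E B. \<forall>p\<in>S. x p = y p} = (\<Pi>\<^sub>E p\<in>I. if p \<in> S then {y p} else B)"
    using assms by (auto simp: PiE_iff extensional_def split: if_splits)
  also have "card \<dots> = (\<Prod>p\<in>I. if p \<in> S then 1 else card B)"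
    using assms(1) by (simp add: card_PiE if_distrib cong: if_cong)
  also have "\<dots> = card B ^ card (I - S)"
    using assms(1,2) by (simp add: prod.If_cases Diff_eq)
  also have "card (I - S) = card I - card S"
    using assms finite_subset by (intro card_Diff_subset) auto
  finally show ?thesis .
qed

text \<open>Moment method over uniformly random bits. The \<open>r\<close>-th powers of the fibre
  sizes count \<open>r\<close>-tuples of vertices inside a fibre; a tuple lies in a given fibre with
  probability 1/2 to the number of distinct bits that it reads. Adding the vertices one at a time,
  \<open>avg\<close> costs a factor \<open>K\<close> each. With \<open>r = card P\<close> the sum
  over all \<open>2^r\<close> patterns loses only a factor 2 in the \<open>r\<close>-th
  root.\<close>

lemma exists_balanced_choice:
  fixes V :: "'a set" and P :: "'p set" and src :: "'p \<Rightarrow> 'a \<Rightarrow> 'b" and K :: real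
  assumes finV: "finite V" and finP: "finite P"
    and avg: "\<And>W. W \<subseteq> V \<Longrightarrow> card W \<le> card P \<Longrightarrow>
      (\<Sum>v\<in>V. (1/2) ^ card {p \<in> P. src p v \<notin> src p ` W}) \<le> K"
  shows "\<exists>X :: 'p \<times> 'b \<Rightarrow> int. (\<forall>p\<in>P. \<forall>v\<in>V. X (p, src p v) \<in> {0, 1}) \<and>
    (\<forall>w\<in>V. real (card {v \<in> V. \<forall>p\<in>P. X (p, src p v) = X (p, src p w)}) \<le> 2 * K)"
proof (cases "P = {}")
  case True
  have "real (card V) \<le> K" using avg[of "{}"] True by simp
  moreover have "0 \<le> real (card V)" by simp
  ultimately show ?thesis using True by auto
next
  case False
  define r where "r = card P"
  have r: "0 < r" using False finP by (simp add: r_def card_gt_0_iff)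
  define Src where "Src W = (\<lambda>(p, v). (p, src p v)) ` (P \<times> W)" for W
  define I where "I = Src V"
  define L where "L k = {xs. set xs \<subseteq> V \<and> length xs = k}" for k
  define XX where "XX = (I \<rightarrow>\<^sub>E {0, 1::int})"
  define Y where "Y = (P \<rightarrow>\<^sub>E {0, 1::int})"
  define fib where "fib X y = {v \<in> V. \<forall>p\<in>P. X (p, src p v) = y p}" for X and y :: "'p \<Rightarrow> int"
  have finL: "finite (L k)" for k unfolding L_def using finV by (rule finite_lists_length_eq)
  have fin_Src: "finite (Src W)" if "finite W" for W using finP that by (simp add: Src_def)
  have finI: "finite I" unfolding I_def using finV by (rule fin_Src)
  have finXX: "finite XX" "XX \<noteq> {}" "card XX = 2 ^ card I"
    using finI by (auto simp: XX_def finite_PiE PiE_eq_empty_iff card_PiE numeral_2_eq_2)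
  have finY: "finite Y" "card Y = 2 ^ r"
    using finP by (auto simp: Y_def r_def finite_PiE card_PiE numeral_2_eq_2)
  have "0 \<le> (\<Sum>v\<in>V. (1/2::real) ^ card {p \<in> P. src p v \<notin> src p ` {}})"
    by (intro sum_nonneg) simp
  also have "\<dots> \<le> K" using avg[of "{}"] by simp
  finally have K: "0 \<le> K" .
  have card_Src: "card (Src (insert v W)) = card (Src W) + card {p \<in> P. src p v \<notin> src p ` W}"
    if "finite W" for v W
  proof -
    have "Src (insert v W) = Src W \<union> (\<lambda>p. (p, src p v)) ` {p \<in> P. src p v \<notin> src p ` W}"
      by (auto simp: Src_def image_iff)
    moreover have "Src W \<inter> (\<lambda>p. (p, src p v)) ` {p \<in> P. src p v \<notin> src p ` W} = {}"
      by (auto simp: Src_def image_iff)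
    ultimately show ?thesis
      using fin_Src[OF that] finP by (simp add: card_Un_disjoint card_image inj_on_def)
  qed
  \<comment> \<open>A new vertex contributes 1/2 for each bit not yet read by the earlier ones, so
    \<open>avg\<close> bounds its sum.\<close>
  have moment: "(\<Sum>xs\<in>L k. (1/2) ^ card (Src (set xs))) \<le> K ^ k" if "k \<le> r" for k
    using that
  proof (induction k)
    case 0
    have "L 0 = {[]}" by (auto simp: L_def)
    then show ?case by (simp add: Src_def)
  next
    case (Suc k)
    have "L (Suc k) = (\<lambda>(xs, v). v # xs) ` (L k \<times> V)"
      unfolding L_def by (rule lists_length_Suc_eq)
    then have "(\<Sum>xs\<in>L (Suc k). (1/2::real) ^ card (Src (set xs))) =
        (\<Sum>(xs, v)\<in>L k \<times> V. (1/2) ^ card (Src (insert v (set xs))))"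
      by (simp add: sum.reindex inj_on_def case_prod_unfold)
    also have "\<dots> = (\<Sum>xs\<in>L k. (1/2) ^ card (Src (set xs)) *
        (\<Sum>v\<in>V. (1/2) ^ card {p \<in> P. src p v \<notin> src p ` set xs}))"
      by (simp add: card_Src power_add sum_distrib_left sum.cartesian_product)
    also have "\<dots> \<le> (\<Sum>xs\<in>L k. (1/2) ^ card (Src (set xs)) * K)"
    proof (intro sum_mono mult_left_mono avg)
      fix xs assume "xs \<in> L k"
      then show "set xs \<subseteq> V" "card (set xs) \<le> card P"
        using Suc.prems card_length[of xs] by (auto simp: L_def r_def)
    qed simp
    also have "\<dots> \<le> K ^ k * K"
      unfolding sum_distrib_right[symmetric] using Suc K by (intro mult_right_mono) auto
    finally show ?case by (simp add: mult.commute)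
  qed
  have fib_pow: "real (card (fib X y)) ^ r = (\<Sum>xs\<in>L r. of_bool (set xs \<subseteq> fib X y))" for X y
  proof -
    have "card (fib X y) ^ r = card {xs. set xs \<subseteq> fib X y \<and> length xs = r}"
      using finV by (simp add: fib_def card_lists_length_eq)
    also have "{xs. set xs \<subseteq> fib X y \<and> length xs = r} = {xs \<in> L r. set xs \<subseteq> fib X y}"
      by (auto simp: L_def fib_def)
    finally show ?thesis
      using finL by (simp add: of_bool_def sum.If_cases Collect_conj_eq Int_commute flip: of_nat_power)
  qed
  \<comment> \<open>The value demanded at \<open>(p, s)\<close> is \<open>y p\<close> for every
    \<open>s\<close>, so the demands of different vertices never conflict and exactly the bits in
    \<open>Src (set xs)\<close> are fixed.\<close>
  have count: "(\<Sum>X\<in>XX. of_bool (set xs \<subseteq> fib X y)) = 2 ^ card I * (1/2::real) ^ card (Src (set xs))"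
    if xs: "xs \<in> L r" and y: "y \<in> Y" for xs y
  proof -
    have sub: "Src (set xs) \<subseteq> I" using xs by (auto simp: Src_def I_def L_def)
    have "{X \<in> XX. set xs \<subseteq> fib X y} = {X \<in> XX. \<forall>q\<in>Src (set xs). X q = y (fst q)}"
      using xs by (auto simp: fib_def Src_def L_def)
    also have "card \<dots> = 2 ^ (card I - card (Src (set xs)))"
      unfolding XX_def using y
      by (subst card_PiE_prescribed[OF finI sub]) (auto simp: Y_def Src_def PiE_iff numeral_2_eq_2)
    finally have "(\<Sum>X\<in>XX. of_bool (set xs \<subseteq> fib X y)) = (2::real) ^ (card I - card (Src (set xs)))"
      using finXX by (simp add: of_bool_def sum.If_cases Collect_conj_eq Int_commute)
    also have "\<dots> = 2 ^ card I * (1/2) ^ card (Src (set xs))"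
      using card_mono[OF finI sub] by (simp add: power_diff power_divide)
    finally show ?thesis .
  qed
  have "(\<Sum>X\<in>XX. \<Sum>y\<in>Y. real (card (fib X y)) ^ r)
      = (\<Sum>y\<in>Y. \<Sum>xs\<in>L r. \<Sum>X\<in>XX. of_bool (set xs \<subseteq> fib X y))"
    unfolding fib_pow by (subst sum.swap) (simp add: sum.swap[of _ XX])
  also have "\<dots> = (\<Sum>y\<in>Y. 2 ^ card I * (\<Sum>xs\<in>L r. (1/2) ^ card (Src (set xs))))"
    by (simp add: count sum_distrib_left)
  also have "\<dots> \<le> (\<Sum>y\<in>Y. 2 ^ card I * K ^ r)"
    by (intro sum_mono mult_left_mono moment) auto
  also have "\<dots> = (\<Sum>X\<in>XX. (2 * K) ^ r)"
    using finY finXX by (simp add: power_mult_distrib)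
  \<comment> \<open>Some choice of bits is no worse than the average.\<close>
  finally have "\<exists>X\<in>XX. (\<Sum>y\<in>Y. real (card (fib X y)) ^ r) \<le> (2 * K) ^ r"
    using finXX by (metis (no_types, lifting) linorder_not_less sum_strict_mono)
  then obtain X where X: "X \<in> XX" and le: "(\<Sum>y\<in>Y. real (card (fib X y)) ^ r) \<le> (2 * K) ^ r"
    by blast
  have range: "X (p, src p v) \<in> {0, 1}" if "p \<in> P" "v \<in> V" for p v
    using X that by (auto simp: XX_def I_def Src_def PiE_iff)
  have "real (card {v \<in> V. \<forall>p\<in>P. X (p, src p v) = X (p, src p w)}) \<le> 2 * K" if w: "w \<in> V" for w
  proof -
    define y where "y = restrict (\<lambda>p. X (p, src p w)) P"
    have y: "y \<in> Y" using range w by (auto simp: y_def Y_def)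
    have "real (card (fib X y)) ^ r \<le> (\<Sum>y\<in>Y. real (card (fib X y)) ^ r)"
      using y finY by (intro member_le_sum) auto
    then have "real (card (fib X y)) ^ r \<le> (2 * K) ^ r" using le by simp
    then have "real (card (fib X y)) \<le> 2 * K" using r K by (metis power_mono_iff mult_nonneg_nonneg of_nat_0_le_iff zero_le_numeral)
    then show ?thesis by (simp add: fib_def y_def cong: conj_cong)
  qed
  then show ?thesis using range by blast
qed

section \<open>Covering every edge twice by self-maps\<close>

lemma exists_two_distinct_below:
  assumes "card {i. i < d \<and> P i} + 2 \<le> d"
  shows "\<exists>i j. i < d \<and> j < d \<and> i \<noteq> j \<and> \<not> P i \<and> \<not> P (j::nat)"
proof -
  have "{i. i < d \<and> \<not> P i} = {..<d} - {i. i < d \<and> P i}" by auto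
  moreover have "card ({..<d} - {i. i < d \<and> P i}) = d - card {i. i < d \<and> P i}"
    by (subst card_Diff_subset) auto
  ultimately have "2 \<le> card {i. i < d \<and> \<not> P i}" using assms by simp
  then show ?thesis
    by (auto simp: numeral_2_eq_2 card_le_Suc_iff)
qed

lemma exists_below:
  assumes "card {i. i < d \<and> P i} < d"
  shows "\<exists>i<d. \<not> P (i::nat)"
proof (rule ccontr)
  assume "\<not> ?thesis"
  then have "{i. i < d \<and> P i} = {..<d}" by auto
  then show False using assms by simp
qed

definition arc_degree :: "('a \<times> 'a) set \<Rightarrow> 'a \<Rightarrow> nat" where
  "arc_degree E v = card {u. (v, u) \<in> E}"

text \<open>Without vertices of degree 1, a walk can go on forever without turning straight back,
  and finiteness makes it repeat a vertex. The condition \<open>s (s v) \<noteq> v\<close> says that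
  the cycle is not a single edge traversed both ways.\<close>

lemma exists_cycle:
  assumes fin: "finite E" and sym: "sym E" and irr: "irrefl E"
    and ne: "E \<noteq> {}" and no_leaf: "\<And>v. arc_degree E v \<noteq> 1"
  shows "\<exists>C s. finite C \<and> C \<noteq> {} \<and> inj_on s C \<and> s ` C = C \<and> (\<forall>v\<in>C. (v, s v) \<in> E \<and> s (s v) \<noteq> v)"
proof -
  have next_ex: "\<exists>w. (v, w) \<in> E \<and> w \<noteq> u" if "(u, v) \<in> E" for u v
  proof (rule ccontr)
    assume "\<nexists>w. (v, w) \<in> E \<and> w \<noteq> u"
    then have "{w. (v, w) \<in> E} = {u}" using symD[OF sym that] by blast
    then show False using no_leaf[of v] by (simp add: arc_degree_def)
  qed
  define nxt where "nxt u v = (SOME w. (v, w) \<in> E \<and> w \<noteq> u)" for u v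
  have nxt: "(v, nxt u v) \<in> E \<and> nxt u v \<noteq> u" if "(u, v) \<in> E" for u v
    unfolding nxt_def by (rule someI_ex[OF next_ex[OF that]])
  obtain e where e: "e \<in> E" using ne by blast
  define a where "a k = ((\<lambda>(u, v). (v, nxt u v)) ^^ k) e" for k
  have aE: "a k \<in> E" for k
    using e nxt by (induction k) (auto simp: a_def case_prod_unfold)
  define w where "w k = fst (a k)" for k
  have a_eq: "a k = (w k, w (Suc k))" for k
    by (simp add: w_def a_def case_prod_unfold)
  have wE: "(w k, w (Suc k)) \<in> E" for k using aE[of k] by (simp add: a_eq)
  have w2: "w (Suc (Suc k)) \<noteq> w k" for k
  proof -
    have "a (Suc k) = (snd (a k), nxt (fst (a k)) (snd (a k)))"
      by (simp add: a_def case_prod_unfold)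
    then have "w (Suc (Suc k)) = nxt (w k) (w (Suc k))" by (simp add: a_eq)
    then show ?thesis using nxt[OF wE[of k]] by simp
  qed
  have "finite (range w)"
    by (rule finite_subset[of _ "fst ` E"]) (use aE fin in \<open>auto simp: w_def\<close>)
  then have "\<not> inj w" using finite_imageD infinite_UNIV_nat by blast
  then have "\<exists>k. \<exists>m. 0 < k \<and> w m = w (m + k)"
    by (metis (no_types, lifting) linorder_injI less_imp_add_positive)
  \<comment> \<open>The gap is minimal over all starting points, so the \<open>k\<close> vertices
    from time \<open>m\<close> on are distinct. Gaps 1 and 2 would be a loop and a reversal.\<close>
  then obtain k where k: "\<exists>m. 0 < k \<and> w m = w (m + k)"
    and k_min: "\<And>k'. k' < k \<Longrightarrow> \<not> (\<exists>m. 0 < k' \<and> w m = w (m + k'))"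
    using exists_least_iff[of "\<lambda>k. \<exists>m. 0 < k \<and> w m = w (m + k)"] by blast
  then obtain m where m: "0 < k" "w m = w (m + k)" by blast
  have "k \<noteq> 1" using wE[of m] m irr by (auto simp: irrefl_def)
  moreover have "k \<noteq> 2" using w2[of m] m by auto
  ultimately have k3: "3 \<le> k" using m(1) by linarith
  \<comment> \<open>The cycle is indexed modulo \<open>k\<close>; the step from \<open>k - 1\<close>
    back to \<open>0\<close> is an edge because \<open>w m = w (m + k)\<close>.\<close>
  define c where "c i = w (m + i mod k)" for i
  have c_inj: "i mod k = j mod k" if "c i = c j" for i j
  proof (rule ccontr)
    assume ne: "i mod k \<noteq> j mod k"
    have *: False if "x < y" "y < k" "w (m + x) = w (m + y)" for x y
      using k_min[of "y - x"] that by (metis add.assoc le_add_diff_inverse less_imp_diff_less less_imp_le_nat zero_less_diff)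
    show False using *[of "i mod k" "j mod k"] *[of "j mod k" "i mod k"] ne that m(1)
      unfolding c_def by (metis linorder_neqE_nat mod_less_divisor)
  qed
  have c_Suc: "(c i, c (Suc i)) \<in> E" for i
  proof -
    have "c (Suc i) = w (m + Suc (i mod k))"
    proof (cases "Suc (i mod k) = k")
      case True
      then have "Suc i mod k = 0" by (simp add: mod_Suc)
      then show ?thesis unfolding c_def True using m(2) by simp
    qed (simp add: c_def mod_Suc)
    then show ?thesis using wE[of "m + i mod k"] by (simp add: c_def)
  qed
  define idx where "idx v = (SOME i. c i = v)" for v
  have idx: "c (idx v) = v" if "v \<in> range c" for v
    using that unfolding idx_def by (auto intro: someI)
  have c_cong: "c i = c j" if "i mod k = j mod k" for i j using that by (simp add: c_def)
  define s where "s v = c (Suc (idx v))" for v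
  have s_c: "s (c i) = c (Suc i)" for i
    using c_inj[of "idx (c i)" i] idx[of "c i"] unfolding s_def
    by (intro c_cong) (simp add: mod_Suc)
  have "finite (range c)"
    by (rule finite_subset[of _ "w ` {m..<m + k}"]) (use m(1) in \<open>auto simp: c_def\<close>)
  moreover have "inj_on s (range c)"
  proof (rule inj_onI)
    fix x y assume "x \<in> range c" "y \<in> range c" "s x = s y"
    then obtain i j where ij: "x = c i" "y = c j" "c (Suc i) = c (Suc j)" by (auto simp: s_c)
    then have "Suc i mod k = Suc j mod k" using c_inj by blast
    then have "(Suc i + (k - 1)) mod k = (Suc j + (k - 1)) mod k" by (rule mod_add_cong) simp
    then have "i mod k = j mod k" using m(1) by simp
    then show "x = y" unfolding ij by (rule c_cong)
  qed
  moreover have "s ` range c = range c"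
  proof
    show "s ` range c \<subseteq> range c" by (auto simp: s_c)
    show "range c \<subseteq> s ` range c"
    proof clarify
      fix i
      have "c i = c (Suc (i + (k - 1)))" using m(1) by (intro c_cong) simp
      then show "c i \<in> s ` range c" by (metis s_c imageI rangeI)
    qed
  qed
  moreover have "(v, s v) \<in> E \<and> s (s v) \<noteq> v" if v: "v \<in> range c" for v
  proof -
    obtain i where i: "v = c i" using v by blast
    have "(i + 2) mod k \<noteq> i mod k"
    proof
      assume "(i + 2) mod k = i mod k"
      then have "k dvd (i + 2) - i" by (metis mod_eq_dvd_iff_nat le_add1)
      then show False using k3 by (auto dest: dvd_imp_le)
    qed
    then have "c (Suc (Suc i)) \<noteq> c i" using c_inj[of "i + 2" i] by auto
    then show ?thesis using c_Suc by (simp add: i s_c)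
  qed
  ultimately show ?thesis by (intro exI[of _ "range c"] exI[of _ s]) auto
qed

text \<open>The two maps may leave from the same endpoint, as for an edge of a removed cycle, or
  from opposite ones, as for a removed leaf edge.\<close>

definition doubly_covers :: "nat \<Rightarrow> (nat \<Rightarrow> 'a \<Rightarrow> 'a) \<Rightarrow> 'a \<Rightarrow> 'a \<Rightarrow> bool" where
  "doubly_covers d g u v \<longleftrightarrow> (\<exists>i j. i < d \<and> j < d \<and> i \<noteq> j \<and>
     (g i u = v \<or> g i v = u) \<and> (g j u = v \<or> g j v = u))"

lemma doubly_covers_commute: "doubly_covers d g u v \<longleftrightarrow> doubly_covers d g v u"
  by (auto simp: doubly_covers_def)

lemma doubly_covers_mono:
  assumes "doubly_covers d g u v" "u \<noteq> v" "\<And>i v. i < d \<Longrightarrow> g i v \<noteq> v \<Longrightarrow> g' i v = g i v"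
  shows "doubly_covers d g' u v"
  using assms unfolding doubly_covers_def by metis

text \<open>Induction on the edges, removing a leaf edge or a cycle. The bound of the used slots at
  \<open>v\<close> by its degree is the invariant: removed edges lower the degree, hence leave slots
  where a map still fixes \<open>v\<close>. Redefining maps only at such fixed points keeps the
  earlier covers.\<close>

lemma double_cover_exists:
  assumes "finite E" "sym E" "irrefl E" "2 \<le> d" "\<And>v. arc_degree E v \<le> d"
  shows "\<exists>g. (\<forall>v. card {i. i < d \<and> g i v \<noteq> v} \<le> arc_degree E v) \<and>
    (\<forall>i<d. \<forall>v. g i v \<noteq> v \<longrightarrow> (v, g i v) \<in> E) \<and> (\<forall>(u, v)\<in>E. doubly_covers d g u v)"
  using assms
proof (induction "card E" arbitrary: E rule: less_induct)
  case less
  note fin = less.prems(1) and sym = less.prems(2) and irr = less.prems(3)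
    and d = less.prems(4) and deg = less.prems(5)
  have fin_nb: "finite {u. (v, u) \<in> E}" for v
    by (rule finite_subset[of _ "snd ` E"]) (force simp: fin)+
  have smaller: "\<exists>g. (\<forall>v. card {i. i < d \<and> g i v \<noteq> v} \<le> arc_degree E' v) \<and>
    (\<forall>i<d. \<forall>v. g i v \<noteq> v \<longrightarrow> (v, g i v) \<in> E') \<and> (\<forall>(u, v)\<in>E'. doubly_covers d g u v)"
    if E': "E' \<subseteq> E" "E' \<noteq> E" "sym E'" for E'
  proof (rule less.hyps)
    show "card E' < card E" using E' fin by (intro psubset_card_mono) auto
    show "finite E'" using E'(1) fin by (rule finite_subset)
    show "irrefl E'" using E'(1) irr by (auto simp: irrefl_def)
    have "arc_degree E' v \<le> arc_degree E v" for v
      unfolding arc_degree_def using E'(1) fin_nb by (intro card_mono) auto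
    then show "arc_degree E' v \<le> d" for v using deg le_trans by blast
  qed (use E' d in auto)
  consider "E = {}" | x where "arc_degree E x = 1" | "E \<noteq> {}" "\<And>v. arc_degree E v \<noteq> 1" by blast
  then show ?case
  proof cases
    case 1
    then show ?thesis by (intro exI[of _ "\<lambda>i v. v"]) simp
  next
    case (2 x)
    then obtain y where y: "{u. (x, u) \<in> E} = {y}" unfolding arc_degree_def by (metis card_1_singletonE)
    then have xy: "(x, y) \<in> E" "(y, x) \<in> E" using symD[OF sym] by auto
    have "x \<noteq> y" using xy irr by (auto simp: irrefl_def)
    define E' where "E' = E - {(x, y), (y, x)}"
    have degx: "arc_degree E' x = 0" using y by (auto simp: arc_degree_def E'_def)
    have "{u. (y, u) \<in> E'} = {u. (y, u) \<in> E} - {x}" using \<open>x \<noteq> y\<close> by (auto simp: E'_def)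
    then have degy: "Suc (arc_degree E' y) = arc_degree E y"
      unfolding arc_degree_def using xy fin_nb card_Suc_Diff1[of "{u. (y, u) \<in> E}" x] by simp
    have degv: "arc_degree E' v = arc_degree E v" if "v \<noteq> x" "v \<noteq> y" for v
      unfolding arc_degree_def E'_def using that by auto
    have "sym E'" using sym by (auto simp: E'_def sym_def)
    then obtain g where g1: "\<And>v. card {i. i < d \<and> g i v \<noteq> v} \<le> arc_degree E' v"
      and g2: "\<And>i v. i < d \<Longrightarrow> g i v \<noteq> v \<Longrightarrow> (v, g i v) \<in> E'"
      and g3: "\<And>u v. (u, v) \<in> E' \<Longrightarrow> doubly_covers d g u v"
      using smaller[of E'] xy unfolding E'_def by fastforce
    have "card {i. i < d \<and> g i y \<noteq> y} < d"
      using g1[of y] degy deg[of y] by linarith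
    then obtain i where i: "i < d" "g i y = y"
      using exists_below[of d "\<lambda>i. g i y \<noteq> y"] by blast
    \<comment> \<open>The leaf \<open>x\<close> is isolated in \<open>E'\<close>, so all its slots
      are free and any index other than \<open>i\<close> will do.\<close>
    obtain j where j: "j < d" "j \<noteq> i" using d by (intro that[of "if i = 0 then 1 else 0"]) auto
    have gx: "g k x = x" if "k < d" for k
      using g1[of x] degx that by (auto simp: card_eq_0_iff)
    define g' where "g' k v = (if k = i \<and> v = y then x else if k = j \<and> v = x then y else g k v)" for k v
    show ?thesis
    proof (intro exI[of _ g'] conjI allI impI ballI)
      fix v
      consider "v = x" | "v = y" | "v \<noteq> x" "v \<noteq> y" by blast
      then show "card {k. k < d \<and> g' k v \<noteq> v} \<le> arc_degree E v"
      proof cases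
        case 1
        have "{k. k < d \<and> g' k v \<noteq> v} \<subseteq> {j}" using 1 \<open>x \<noteq> y\<close> gx by (auto simp: g'_def)
        from card_mono[OF _ this] show ?thesis using 1 \<open>arc_degree E x = 1\<close> by simp
      next
        case 2
        have "{k. k < d \<and> g' k v \<noteq> v} \<subseteq> insert i {k. k < d \<and> g k v \<noteq> v}"
          using 2 \<open>x \<noteq> y\<close> by (auto simp: g'_def)
        then have "card {k. k < d \<and> g' k v \<noteq> v} \<le> card (insert i {k. k < d \<and> g k v \<noteq> v})"
          by (intro card_mono) auto
        also have "\<dots> \<le> Suc (card {k. k < d \<and> g k v \<noteq> v})" by (rule card_insert_le_m1) auto
        also have "\<dots> \<le> arc_degree E v" using g1[of y] degy 2 by simp
        finally show ?thesis .
      next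
        case 3
        then have "{k. k < d \<and> g' k v \<noteq> v} = {k. k < d \<and> g k v \<noteq> v}" by (auto simp: g'_def)
        then show ?thesis using g1[of v] degv[OF 3] by simp
      qed
    next
      fix k v assume "k < d" "g' k v \<noteq> v"
      then show "(v, g' k v) \<in> E"
        using g2[of k v] xy by (auto simp: g'_def E'_def split: if_splits)
    next
      fix e assume e: "e \<in> E"
      have keep: "g' k v = g k v" if "k < d" "g k v \<noteq> v" for k v
        using that i gx by (auto simp: g'_def)
      have "doubly_covers d g' x y"
        unfolding doubly_covers_def using i j \<open>x \<noteq> y\<close>
        by (intro exI[of _ i] exI[of _ j]) (auto simp: g'_def)
      then have new: "doubly_covers d g' x y" "doubly_covers d g' y x"
        using doubly_covers_commute by metis+
      show "case e of (u, v) \<Rightarrow> doubly_covers d g' u v"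
      proof (cases "e \<in> E'")
        case True
        then have "fst e \<noteq> snd e" using irr by (cases e) (auto simp: E'_def irrefl_def)
        then show ?thesis using True g3 keep by (auto intro: doubly_covers_mono[of d g])
      next
        case False
        then show ?thesis using e new by (auto simp: E'_def)
      qed
    qed
  next
    case 3
    obtain C s where C: "finite C" "C \<noteq> {}" "inj_on s C" "s ` C = C"
      and s: "\<And>v. v \<in> C \<Longrightarrow> (v, s v) \<in> E" "\<And>v. v \<in> C \<Longrightarrow> s (s v) \<noteq> v"
      using exists_cycle[OF fin sym irr 3] by metis
    define O' where "O' = (\<lambda>v. (v, s v)) ` C"
    define E' where "E' = E - (O' \<union> O'\<inverse>)"
    have "sym E'" using sym by (auto simp: E'_def sym_def)
    moreover have "E' \<noteq> E" using C(2) s(1) by (auto simp: E'_def O'_def)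
    ultimately obtain g where g1: "\<And>v. card {i. i < d \<and> g i v \<noteq> v} \<le> arc_degree E' v"
      and g2: "\<And>i v. i < d \<Longrightarrow> g i v \<noteq> v \<Longrightarrow> (v, g i v) \<in> E'"
      and g3: "\<And>u v. (u, v) \<in> E' \<Longrightarrow> doubly_covers d g u v"
      using smaller[of E'] unfolding E'_def by fastforce
    have deg_le: "arc_degree E' v \<le> arc_degree E v" for v
      unfolding arc_degree_def E'_def using fin_nb by (intro card_mono) auto
    \<comment> \<open>The predecessor and the successor of \<open>v\<close> on the cycle are two
      different neighbours, and both edges are removed. This frees two slots at \<open>v\<close>,
      both to be spent on the successor.\<close>
    have deg2: "arc_degree E' v + 2 \<le> arc_degree E v" if v: "v \<in> C" for v
    proof -
      obtain u where u: "u \<in> C" "v = s u" using C(4) v by blast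
      have "u \<noteq> s v" using s(2)[OF u(1)] u(2) by simp
      have "{w. (v, w) \<in> E'} \<subseteq> {w. (v, w) \<in> E} - {u, s v}"
        using v u by (auto simp: E'_def O'_def)
      then have "arc_degree E' v \<le> card ({w. (v, w) \<in> E} - {u, s v})"
        unfolding arc_degree_def using fin_nb by (intro card_mono) auto
      also have "\<dots> = arc_degree E v - 2"
        using s(1)[OF v] symD[OF sym s(1)[OF u(1)]] u \<open>u \<noteq> s v\<close> fin_nb
        unfolding arc_degree_def by (subst card_Diff_subset) auto
      finally have "arc_degree E' v \<le> arc_degree E v - 2" .
      moreover have "card {u, s v} \<le> arc_degree E v"
        unfolding arc_degree_def using fin_nb s(1)[OF v] symD[OF sym s(1)[OF u(1)]] u
        by (intro card_mono) auto
      ultimately show ?thesis using \<open>u \<noteq> s v\<close> by simp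
    qed
    have "\<exists>i j. i < d \<and> j < d \<and> i \<noteq> j \<and> g i v = v \<and> g j v = v" if "v \<in> C" for v
      using exists_two_distinct_below[of d "\<lambda>i. g i v \<noteq> v"] g1[of v] deg2[OF that] deg[of v]
      by auto
    then obtain p q where pq: "\<And>v. v \<in> C \<Longrightarrow>
        p v < d \<and> q v < d \<and> p v \<noteq> q v \<and> g (p v) v = v \<and> g (q v) v = v"
      by metis
    define g' where "g' k v = (if v \<in> C \<and> (k = p v \<or> k = q v) then s v else g k v)" for k v
    show ?thesis
    proof (intro exI[of _ g'] conjI allI impI ballI)
      fix v
      show "card {k. k < d \<and> g' k v \<noteq> v} \<le> arc_degree E v"
      proof (cases "v \<in> C")
        case True
        have "{k. k < d \<and> g' k v \<noteq> v} \<subseteq> {k. k < d \<and> g k v \<noteq> v} \<union> {p v, q v}"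
          by (auto simp: g'_def)
        then have "card {k. k < d \<and> g' k v \<noteq> v} \<le> card ({k. k < d \<and> g k v \<noteq> v} \<union> {p v, q v})"
          by (intro card_mono) auto
        also have "\<dots> \<le> card {k. k < d \<and> g k v \<noteq> v} + card {p v, q v}" by (rule card_Un_le)
        also have "\<dots> \<le> arc_degree E v"
          using g1[of v] deg2[OF True] by (simp add: card_insert_if)
        finally show ?thesis .
      next
        case False
        then show ?thesis using g1[of v] deg_le[of v] by (simp add: g'_def)
      qed
    next
      fix k v assume "k < d" "g' k v \<noteq> v"
      then show "(v, g' k v) \<in> E"
        using g2[of k v] s(1) by (auto simp: g'_def E'_def split: if_splits)
    next
      fix e assume e: "e \<in> E"
      have keep: "g' k v = g k v" if "g k v \<noteq> v" for k v
        using that pq by (auto simp: g'_def)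
      have new: "doubly_covers d g' v (s v)" if "v \<in> C" for v
        unfolding doubly_covers_def using pq[OF that] that
        by (intro exI[of _ "p v"] exI[of _ "q v"]) (auto simp: g'_def)
      show "case e of (u, v) \<Rightarrow> doubly_covers d g' u v"
      proof (cases "e \<in> E'")
        case True
        then have "fst e \<noteq> snd e" using irr by (cases e) (auto simp: E'_def irrefl_def)
        then show ?thesis using True g3 keep by (auto intro: doubly_covers_mono[of d g])
      next
        case False
        then show ?thesis using e new doubly_covers_commute[of d g'] by (auto simp: E'_def O'_def)
      qed
    qed
  qed
qed

section \<open>The generating set and the embedding\<close>

text \<open>Numbers each fibre separately; the values of \<open>h\<close> become the extra
  coordinates that make the embedding injective.\<close>

lemma exists_fibrewise_injection:
  assumes "finite V" "finite B" "\<And>w. w \<in> V \<Longrightarrow> card {v \<in> V. f v = f w} \<le> card B"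
  shows "\<exists>h. h ` V \<subseteq> B \<and> inj_on (\<lambda>v. (f v, h v)) V"
proof -
  have "\<exists>k. k ` {v \<in> V. f v = y} \<subseteq> B \<and> inj_on k {v \<in> V. f v = y}" for y
  proof (cases "\<exists>w\<in>V. f w = y")
    case True
    then have "card {v \<in> V. f v = y} \<le> card B" using assms(3) by blast
    then show ?thesis using card_le_inj[of "{v \<in> V. f v = y}" B] assms by simp
  next
    case False
    then have empty: "{v \<in> V. f v = y} = {}" by blast
    show ?thesis unfolding empty by simp
  qed
  then have "\<exists>k. \<forall>y. k y ` {v \<in> V. f v = y} \<subseteq> B \<and> inj_on (k y) {v \<in> V. f v = y}"
    by (intro choice allI)
  then obtain k where k: "\<And>y. k y ` {v \<in> V. f v = y} \<subseteq> B \<and> inj_on (k y) {v \<in> V. f v = y}"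
    by blast
  show ?thesis
  proof (intro exI[of _ "\<lambda>v. k (f v) v"] conjI)
    show "(\<lambda>v. k (f v) v) ` V \<subseteq> B" using k by blast
    show "inj_on (\<lambda>v. (f v, k (f v) v)) V"
    proof (rule inj_onI)
      fix v w assume "v \<in> V" "w \<in> V" "(f v, k (f v) v) = (f w, k (f w) w)"
      then show "v = w" using k[of "f w"] by (auto dest: inj_onD)
    qed
  qed
qed

section \<open>Powers of Z_2, with a one-element second factor given by positive parameters\<close>

lemma carrier_Z2_Zq_group_trivial:
  "carrier (Z2_Zq_group N 1 1) = ({..<N} \<rightarrow>\<^sub>E {0, 1}) \<times> {\<lambda>i\<in>{..<1}. 0}"
proof -
  have "{0..<2::int} = {0, 1}" by auto
  moreover have "{0..<1::int} = {0}" by auto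
  moreover have "({..<Suc 0} \<rightarrow>\<^sub>E {0::int}) = {\<lambda>i\<in>{..<Suc 0}. 0}" 
    using PiE_singleton[of "\<lambda>i\<in>{..<Suc 0}. 0::int" "{..<Suc 0}"] by (simp cong: PiE_cong)
  ultimately show ?thesis
    by (simp add: Z2_Zq_group_def DirProd_def carrier_integer_mod_group)
qed

lemma mult_Z2_Zq_group_trivial:
  "(x, z) \<otimes>\<^bsub>Z2_Zq_group N 1 1\<^esub> (y, z') =
     (\<lambda>i\<in>{..<N}. (x i + y i) mod 2, \<lambda>i\<in>{..<1}. 0)"
  by (simp add: Z2_Zq_group_def DirProd_def integer_mod_group_def)


text \<open>
  Coordinate \<open>(i, c, b)\<close> is bit \<open>b\<close> of cell \<open>c\<close> in block \<open>i\<close>.  Two bits per cell make \<open>2\<^sup>-\<^sup>2\<close> per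
  fresh cell outweigh the growth of backward orbits already for \<open>d = 3\<close>.
\<close>

definition positions :: "nat \<Rightarrow> nat \<Rightarrow> (nat \<times> nat \<times> nat) set" where
  "positions d t = {..<d} \<times> {..<t} \<times> {..<2}"

lemma finite_positions [simp]: "finite (positions d t)"
  by (simp add: positions_def)

lemma card_positions [simp]: "card (positions d t) = 2 * t * d"
  by (simp add: positions_def card_cartesian_product)

definition off_cell :: "nat \<Rightarrow> nat \<Rightarrow> nat \<Rightarrow> (nat \<times> nat \<times> nat) set" where
  "off_cell t i c = {i} \<times> ({..<t} - {c}) \<times> {..<2}"

lemma off_cell_subset: "i < d \<Longrightarrow> off_cell t i c \<subseteq> positions d t"
  by (auto simp: off_cell_def positions_def)

lemma card_off_cell_ge: "2 * t - 2 \<le> card (off_cell t i c)"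
proof -
  have "t - 1 \<le> card ({..<t} - {c})"
    using diff_card_le_card_Diff[of "{c}" "{..<t}"] by simp
  then show ?thesis by (simp add: off_cell_def card_cartesian_product)
qed

text \<open>The exempt cells may be \<open>t\<close>, i.e. absent, so that the set is nonempty also for \<open>t = 0\<close>.\<close>

definition two_block_set :: "((nat \<times> nat \<times> nat) \<Rightarrow> nat) \<Rightarrow> nat \<Rightarrow> nat \<Rightarrow> nat \<Rightarrow> ((nat \<Rightarrow> int) \<times> (nat \<Rightarrow> int)) set" where
  "two_block_set e d t N = (\<Union>(i, j, c, c')\<in>{(i, j, c, c'). i < d \<and> j < d \<and> i \<noteq> j \<and> c \<le> t \<and> c' \<le> t}.
     {x \<in> {..<N} \<rightarrow>\<^sub>E {0, 1}. \<forall>p \<in> e ` (off_cell t i c \<union> off_cell t j c'). x p = 0} \<times> {\<lambda>i\<in>{..<1}. 0})"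

lemma two_block_set_subset: "two_block_set e d t N \<subseteq> carrier (Z2_Zq_group N 1 1)"
  unfolding carrier_Z2_Zq_group_trivial two_block_set_def by auto

text \<open>Union bound over blocks and exempt cells. Because \<open>i \<noteq> j\<close>, the two
  off-cell sets are disjoint and together fix at least \<open>4 * t - 4\<close> coordinates.\<close>

lemma card_two_block_set_le:
  assumes e: "inj_on e (positions d t)" "e ` positions d t \<subseteq> {..<N}"
  shows "card (two_block_set e d t N) \<le> d ^ 2 * (t + 1) ^ 2 * 2 ^ (N - (4 * t - 4))"
proof -
  let ?I = "{(i, j, c, c'). i < d \<and> j < d \<and> i \<noteq> j \<and> c \<le> t \<and> c' \<le> t}"
  let ?S = "\<lambda>i j c c'. e ` (off_cell t i c \<union> off_cell t j c')"
  let ?A = "\<lambda>(i, j, c, c'). {x \<in> {..<N} \<rightarrow>\<^sub>E {0, 1::int}. \<forall>p \<in> ?S i j c c'. x p = 0}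
    \<times> {\<lambda>i\<in>{..<1::nat}. 0::int}"
  have I_sub: "?I \<subseteq> {..<d} \<times> {..<d} \<times> {..t} \<times> {..t}" by auto
  have finI: "finite ?I" by (rule finite_subset[OF I_sub]) simp
  have card_A: "card (?A q) \<le> 2 ^ (N - (4 * t - 4))" if q_I: "q \<in> ?I" for q
  proof -
    obtain i j c c' where q: "q = (i, j, c, c')" "i < d" "j < d" "i \<noteq> j" using q_I by blast
    have sub: "off_cell t i c \<union> off_cell t j c' \<subseteq> positions d t"
      using q off_cell_subset by simp
    have fin: "finite (off_cell t i c)" for i c by (simp add: off_cell_def)
    have "card (?S i j c c') = card (off_cell t i c \<union> off_cell t j c')"
      using inj_on_subset[OF e(1) sub] by (rule card_image)
    also have "\<dots> = card (off_cell t i c) + card (off_cell t j c')"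
      using q(4) fin by (intro card_Un_disjoint) (auto simp: off_cell_def)
    finally have "4 * t - 4 \<le> card (?S i j c c')"
      using card_off_cell_ge[of t i c] card_off_cell_ge[of t j c'] by linarith
    moreover have "?S i j c c' \<subseteq> {..<N}" using sub e(2) by blast
    ultimately show ?thesis
      using card_PiE_prescribed[of "{..<N}" "?S i j c c'" "\<lambda>_. 0" "{0, 1::int}"]
      by (auto simp: q(1) card_cartesian_product numeral_2_eq_2 intro!: power_increasing)
  qed
  have "card (two_block_set e d t N) \<le> (\<Sum>q\<in>?I. card (?A q))"
    unfolding two_block_set_def by (rule card_UN_le[OF finI])
  also have "\<dots> \<le> (\<Sum>q\<in>?I. 2 ^ (N - (4 * t - 4)))" by (intro sum_mono card_A)
  also have "\<dots> = card ?I * 2 ^ (N - (4 * t - 4))" by simp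
  also have "card ?I \<le> card ({..<d} \<times> {..<d} \<times> {..t} \<times> {..t})"
    by (rule card_mono[OF _ I_sub]) simp
  also have "\<dots> = d ^ 2 * (t + 1) ^ 2" by (simp add: card_cartesian_product power2_eq_square algebra_simps)
  finally show ?thesis by simp
qed

text \<open>The set depends on neither \<open>F\<close> nor its double cover; only \<phi> does.
  Hypothesis \<open>l\<close> says that the \<open>l\<close> free coordinates can number every fibre
  of the balanced choice.\<close>

lemma two_block_set_universal:
  fixes F :: "'a pair_pre_digraph"
  assumes e: "bij_betw e (positions d t) {..<2 * t * d}" and d: "3 \<le> d"
    and F: "pair_graph F" "card (pverts F) = n" "\<And>v. v \<in> pverts F \<Longrightarrow> out_degree (with_proj F) v \<le> d"
    and l: "2 * (real n / 4 ^ (t * d) + 4 * real d * real (2 * t * d) * real t) \<le> 2 ^ l"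
  shows "\<exists>\<phi>. inj_on \<phi> (pverts F) \<and> \<phi> ` pverts F \<subseteq> carrier (Z2_Zq_group (2 * t * d + l) 1 1) \<and>
    (\<forall>(u, v)\<in>parcs F. \<phi> u \<otimes>\<^bsub>Z2_Zq_group (2 * t * d + l) 1 1\<^esub> \<phi> v \<in> two_block_set e d t (2 * t * d + l))"
proof -
  interpret F: pair_graph F by fact
  define N where "N = 2 * t * d + l"
  define V where "V = pverts F"
  define E where "E = parcs F"
  have finV: "finite V" unfolding V_def by (rule F.pair_finite_verts)
  have E_V: "u \<in> V" "v \<in> V" if "(u, v) \<in> E" for u v
    using that F.arc_fst_in_verts[of "(u, v)"] F.arc_snd_in_verts[of "(u, v)"] by (auto simp: E_def V_def)
  have finE: "finite E" unfolding E_def by (rule F.pair_finite_arcs)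
  have symE: "sym E" using F.pair_sym_arcs by (simp add: E_def symmetric_def)
  have irrE: "irrefl E" using F.pair_no_loops by (force simp: E_def irrefl_def)
  have degE: "arc_degree E v \<le> d" for v
  proof (cases "v \<in> V")
    case True
    have "out_arcs (with_proj F) v = Pair v ` {u. (v, u) \<in> E}"
      by (auto simp: out_arcs_def E_def)
    then have "out_degree (with_proj F) v = arc_degree E v"
      by (simp add: out_degree_def arc_degree_def card_image inj_on_def)
    then show ?thesis using F(3)[of v] True by (simp add: V_def)
  next
    case False
    then have "{u. (v, u) \<in> E} = {}" using E_V by blast
    then show ?thesis by (simp add: arc_degree_def)
  qed
  have "2 \<le> d" using d by simp
  from double_cover_exists[OF finE symE irrE this degE]
  obtain g where g_E: "\<And>i v. i < d \<Longrightarrow> g i v \<noteq> v \<Longrightarrow> (v, g i v) \<in> E"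
    and cover: "\<And>u v. (u, v) \<in> E \<Longrightarrow> doubly_covers d g u v"
    by blast
  have g_closed: "g i v \<in> V" if "i < d" "v \<in> V" for i v
    using g_E[OF that(1), of v] E_V that(2) by metis
  \<comment> \<open>A preimage of \<open>u\<close> is \<open>u\<close> itself or a neighbour of
    \<open>u\<close>.\<close>
  have g_deg: "card {v \<in> V. g i v = u} \<le> Suc d" if "i < d" for i u
  proof -
    have fin_nb: "finite {w. (u, w) \<in> E}"
      by (rule finite_subset[OF _ finV]) (use E_V in auto)
    have "{v \<in> V. g i v = u} \<subseteq> insert u {w. (u, w) \<in> E}"
    proof
      fix v assume "v \<in> {v \<in> V. g i v = u}"
      then have "g i v = u" by simp
      then show "v \<in> insert u {w. (u, w) \<in> E}"
        using g_E[OF that, of v] symD[OF symE, of v u] by (cases "v = u") auto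
    qed
    then have "card {v \<in> V. g i v = u} \<le> card (insert u {w. (u, w) \<in> E})"
      using fin_nb by (intro card_mono) auto
    also have "\<dots> \<le> Suc (arc_degree E u)"
      unfolding arc_degree_def by (rule card_insert_le_m1) auto
    finally show ?thesis using degE[of u] by simp
  qed
  define src where "src i = finite_self_map.source (g i) t" for i
  define psrc where "psrc q = src (fst q) (fst (snd q))" for q :: "nat \<times> nat \<times> nat"
  define lab where "lab i = finite_self_map.label (g i) t" for i
  define K where "K = real n / 4 ^ (t * d) + 4 * real d * real (2 * t * d) * real t"
  have fresh_sum: "(\<Sum>v\<in>V. (1/2) ^ card {q \<in> positions d t. psrc q v \<notin> psrc q ` W}) \<le> K"
    if W: "W \<subseteq> V" "card W \<le> card (positions d t)" for W
  proof -
    \<comment> \<open>Both bits of a cell have the same source, whence the factor 2.\<close>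
    have "card {q \<in> positions d t. psrc q v \<notin> psrc q ` W}
        = (\<Sum>i<d. 2 * card {c. c < t \<and> src i c v \<notin> src i c ` W})" for v
    proof -
      have "{q \<in> positions d t. psrc q v \<notin> psrc q ` W}
          = (SIGMA i:{..<d}. {c. c < t \<and> src i c v \<notin> src i c ` W} \<times> {..<2})"
        unfolding positions_def psrc_def by auto
      then show ?thesis by (simp add: card_cartesian_product mult.commute)
    qed
    \<comment> \<open>Here \<open>r\<close> is the number of positions, which is also the order of
      the moment.\<close>
    then show ?thesis
      using sum_fresh_weight_le[OF finV g_closed g_deg d W(1), where r = "2 * t * d" and t = t] W(2) F(2)
      unfolding src_def K_def V_def by simp
  qed
  have "\<exists>X :: (nat \<times> nat \<times> nat) \<times> 'a \<Rightarrow> int.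
      (\<forall>q\<in>positions d t. \<forall>v\<in>V. X (q, psrc q v) \<in> {0, 1}) \<and>
      (\<forall>w\<in>V. real (card {v \<in> V. \<forall>q\<in>positions d t. X (q, psrc q v) = X (q, psrc q w)}) \<le> 2 * K)"
    by (rule exists_balanced_choice[OF finV finite_positions]) (rule fresh_sum)
  then obtain X :: "(nat \<times> nat \<times> nat) \<times> 'a \<Rightarrow> int"
    where X01: "\<forall>q\<in>positions d t. \<forall>v\<in>V. X (q, psrc q v) \<in> {0, 1}"
    and X_fib: "\<forall>w\<in>V. real (card {v \<in> V. \<forall>q\<in>positions d t.
        X (q, psrc q v) = X (q, psrc q w)}) \<le> 2 * K"
    by (elim exE conjE)
  define val where "val v = (\<lambda>q\<in>positions d t. X (q, psrc q v))" for v
  define B where "B = ({2 * t * d..<N} \<rightarrow>\<^sub>E {0, 1::int})"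
  have finB: "finite B" and cardB: "card B = 2 ^ l"
    by (auto simp: B_def N_def finite_PiE card_PiE numeral_2_eq_2)
  have val_eq_iff: "val v = val w \<longleftrightarrow> (\<forall>q\<in>positions d t. X (q, psrc q v) = X (q, psrc q w))" for v w
  proof
    assume eq: "val v = val w"
    show "\<forall>q\<in>positions d t. X (q, psrc q v) = X (q, psrc q w)"
    proof
      fix q assume "q \<in> positions d t"
      then show "X (q, psrc q v) = X (q, psrc q w)" using fun_cong[OF eq, of q] by (simp add: val_def)
    qed
  next
    assume "\<forall>q\<in>positions d t. X (q, psrc q v) = X (q, psrc q w)"
    then show "val v = val w" unfolding val_def by (intro restrict_ext) blast
  qed
  have "card {v \<in> V. val v = val w} \<le> card B" if "w \<in> V" for w
  proof -
    have "real (card {v \<in> V. val v = val w}) \<le> 2 * K"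
      unfolding val_eq_iff by (rule bspec[OF X_fib that])
    also have "\<dots> \<le> 2 ^ l" unfolding K_def by (rule l)
    finally have "real (card {v \<in> V. val v = val w}) \<le> 2 ^ l" .
    then show ?thesis unfolding cardB by (metis of_nat_le_iff of_nat_numeral of_nat_power)
  qed
  then obtain h where hB: "h ` V \<subseteq> B" and h_inj: "inj_on (\<lambda>v. (val v, h v)) V"
    using exists_fibrewise_injection[OF finV finB] by blast
  \<comment> \<open>The first \<open>2 * t * d\<close> coordinates hold the symbols, transported
    along \<open>e\<close>; the last \<open>l\<close> hold the number within the fibre.\<close>
  define x where "x v = (\<lambda>p\<in>{..<N}. if p < 2 * t * d then val v (inv_into (positions d t) e p) else h v p)" for v
  define \<phi> where "\<phi> v = (x v, \<lambda>i\<in>{..<1::nat}. 0::int)" for v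
  have e_lt: "e q < 2 * t * d" if "q \<in> positions d t" for q
    using bij_betwE[OF e] that by auto
  have x_e: "x v (e q) = val v q" if "q \<in> positions d t" for v q
    using e_lt[OF that] bij_betw_inv_into_left[OF e that] by (simp add: x_def N_def)
  have x01: "x v \<in> {..<N} \<rightarrow>\<^sub>E {0, 1}" if "v \<in> V" for v
  proof (rule PiE_I)
    fix p assume p: "p \<in> {..<N}"
    show "x v p \<in> {0, 1}"
    proof (cases "p < 2 * t * d")
      case True
      then obtain q where "q \<in> positions d t" "p = e q" using e by (metis bij_betw_iff_bijections lessThan_iff)
      then show ?thesis using x_e X01 that by (simp add: val_def)
    next
      case False
      then have "p \<in> {2 * t * d..<N}" using p by simp
      moreover have "h v \<in> {2 * t * d..<N} \<rightarrow>\<^sub>E {0, 1}" using hB that unfolding B_def by blast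
      ultimately have "h v p \<in> {0, 1}" by (rule PiE_mem[rotated])
      then show ?thesis using p False by (simp add: x_def)
    qed
  qed (simp add: x_def)
  have "inj_on \<phi> V"
  proof (rule inj_onI)
    fix v w assume vw: "v \<in> V" "w \<in> V" "\<phi> v = \<phi> w"
    then have eq: "x v = x w" by (simp add: \<phi>_def)
    have "val v q = val w q" for q
      using x_e[of q v] x_e[of q w] eq by (cases "q \<in> positions d t") (auto simp: val_def)
    moreover have "h v p = h w p" for p
    proof (cases "p \<in> {2 * t * d..<N}")
      case True
      then show ?thesis using fun_cong[OF eq, of p] by (simp add: x_def)
    next
      case False
      have "h v \<in> B" "h w \<in> B" using hB vw(1,2) by blast+
      from this[unfolded B_def, THEN PiE_arb, OF False] show ?thesis by simp
    qed
    ultimately have "(val v, h v) = (val w, h w)" by auto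
    then show "v = w" using inj_onD[OF h_inj _ vw(1,2)] by simp
  qed
  moreover have "\<phi> ` V \<subseteq> carrier (Z2_Zq_group N 1 1)"
    unfolding carrier_Z2_Zq_group_trivial \<phi>_def by (intro image_subsetI SigmaI x01 singletonI)
  moreover have "\<phi> u \<otimes>\<^bsub>Z2_Zq_group N 1 1\<^esub> \<phi> v \<in> two_block_set e d t N" if uv: "(u, v) \<in> E" for u v
  proof -
    have agree: "\<exists>c\<le>t. \<forall>q\<in>off_cell t i c. val u q = val v q"
      if i: "i < d" and gi: "g i u = v \<or> g i v = u" for i
    proof (cases "t = 0")
      case True
      then show ?thesis by (auto simp: off_cell_def)
    next
      case False
      interpret G: finite_self_map V "g i" t
        using finV g_closed[OF i] False by unfold_locales auto
      \<comment> \<open>The exempt cell is the label of the endpoint that \<open>g i\<close> sends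
        to the other one.\<close>
      define c where "c = (if g i u = v then lab i u else lab i v)"
      have src_eq: "src i c' u = src i c' v" if "c' \<noteq> c" for c'
      proof (cases "g i u = v")
        case True
        then show ?thesis using that G.source_step[of c' u] by (simp add: c_def lab_def src_def)
      next
        case False
        then show ?thesis using that gi G.source_step[of c' v] by (simp add: c_def lab_def src_def)
      qed
      have "val u q = val v q" if q: "q \<in> off_cell t i c" for q
      proof -
        have "q \<in> positions d t" using q off_cell_subset[OF i] by blast
        moreover have "psrc q u = psrc q v"
        proof -
          have "fst (snd q) \<noteq> c" "fst q = i" using q by (auto simp: off_cell_def)
          then show ?thesis using src_eq[of "fst (snd q)"] by (simp add: psrc_def)
        qed
        ultimately show ?thesis by (simp add: val_def)
      qed
      moreover have "c \<le> t"
        unfolding c_def lab_def G.label_def using mod_less_divisor[OF G.t_pos] by (simp add: less_imp_le)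
      ultimately show ?thesis by blast
    qed
    obtain i j where ij: "i < d" "j < d" "i \<noteq> j"
      and gi: "g i u = v \<or> g i v = u" and gj: "g j u = v \<or> g j v = u"
      using cover[OF uv] unfolding doubly_covers_def by (elim exE conjE)
    obtain c where c: "c \<le> t" "\<forall>q\<in>off_cell t i c. val u q = val v q"
      using agree[OF ij(1) gi] by (elim exE conjE)
    obtain c' where c': "c' \<le> t" "\<forall>q\<in>off_cell t j c'. val u q = val v q"
      using agree[OF ij(2) gj] by (elim exE conjE)
    have eq: "val u q = val v q" if "q \<in> off_cell t i c \<union> off_cell t j c'" for q
      using that c(2) c'(2) by (elim UnE) (rule bspec; assumption)+
    have V: "u \<in> V" "v \<in> V" using E_V[OF uv] by auto
    define y where "y = (\<lambda>p\<in>{..<N}. (x u p + x v p) mod 2)"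
    have "y \<in> {..<N} \<rightarrow>\<^sub>E {0, 1}"
    proof (rule PiE_I)
      fix p assume "p \<in> {..<N}"
      then show "y p \<in> {0, 1}"
        using PiE_mem[OF x01[OF V(1)], of p] PiE_mem[OF x01[OF V(2)], of p] by (auto simp: y_def)
    qed (simp add: y_def)
    \<comment> \<open>Outside the exempt cells both endpoints show the same bit, and twice a bit is
      even.\<close>
    moreover have "y (e q) = 0" if q: "q \<in> off_cell t i c \<union> off_cell t j c'" for q
    proof -
      have q': "q \<in> positions d t" using q off_cell_subset[OF ij(1)] off_cell_subset[OF ij(2)] by blast
      have "x u (e q) = x v (e q)" using eq[OF q] x_e[OF q'] by simp
      moreover have "e q < N" using e_lt[OF q'] by (simp add: N_def)
      ultimately show ?thesis by (simp add: y_def flip: mult_2)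
    qed
    ultimately have "(y, \<lambda>i\<in>{..<1}. 0) \<in> two_block_set e d t N"
      unfolding two_block_set_def using ij c(1) c'(1) by (intro UN_I[of "(i, j, c, c')"]) auto
    then show ?thesis unfolding \<phi>_def mult_Z2_Zq_group_trivial y_def .
  qed
  ultimately show ?thesis unfolding V_def E_def N_def by blast
qed

section \<open>Choice of parameters\<close>

text \<open>Makes \<open>t = 0\<close> admissible in the choice of \<open>t\<close> below. In terms
  of the fourth root \<open>y\<close> of \<open>x\<close>, it reduces to \<open>(y - 2)^2\<close>
  being nonnegative.\<close>

lemma ln_squared_le_self:
  assumes "1 \<le> (x::real)" shows "(ln x)\<^sup>2 \<le> x"
proof -
  define y where "y = x powr (1/4)"
  have y: "0 < y" "x = y ^ 4"
    using assms by (auto simp: y_def powr_powr simp flip: powr_realpow)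
  have "ln x = 4 * ln y" using y by (simp add: ln_realpow)
  also have "\<dots> \<le> 4 * (y - 1)" using ln_le_minus_one[OF y(1)] by simp
  also have "\<dots> \<le> y\<^sup>2" using zero_le_power2[of "y - 2"] by (simp add: power2_eq_square algebra_simps)
  finally have "ln x \<le> y\<^sup>2" .
  then have "(ln x)\<^sup>2 \<le> (y\<^sup>2)\<^sup>2" using assms by (intro power_mono) auto
  then show ?thesis using y(2) by simp
qed

text \<open>If \<open>ln n < 1\<close>, the denominator is at most 0 and so is the ratio. This
  includes \<open>n = 1\<close>, through the default values \<open>ln 0 = 0\<close> and
  \<open>0 / 0 = 0\<close>.\<close>

lemma ln_ge_1_if_three_le_ratio:
  assumes "0 < n" "3 \<le> ln (real n) / ln (ln (real n))"
  shows "1 \<le> ln (real n)"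
proof (rule ccontr)
  assume *: "\<not> 1 \<le> ln (real n)"
  have "0 \<le> ln (real n)" using assms(1) by simp
  then have "ln (ln (real n)) \<le> 0" using * by (cases "ln (real n) = 0") auto
  then have "ln (real n) / ln (ln (real n)) \<le> 0"
    using \<open>0 \<le> ln (real n)\<close> by (rule divide_nonneg_nonpos[rotated])
  then show False using assms(2) by simp
qed

text \<open>Take \<open>t\<close> maximal such that the average fibre size
  \<open>n / 4^(t*d)\<close> is still at least \<open>(ln n)^2\<close>. Then the average dominates
  the error term of the moment bound, and maximality makes the saving \<open>16^t\<close> as large
  as \<open>n^(2/d)\<close> up to a constant and a power of \<open>ln n\<close>.\<close>

lemma universal_generating_set_exists:
  fixes n d :: nat
  assumes n: "0 < n" and d: "3 \<le> d" and L1: "1 \<le> ln (real n)"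
  shows "\<exists>t1>0. \<exists>U \<subseteq> carrier (Z2_Zq_group t1 1 1).
    real (card U) \<le> 36864 * real n powr (1 - 2 / real d) * (real d)\<^sup>2 * ln (real n) powr (2 + 4 / real d) \<and>
    (\<forall>F :: nat pair_pre_digraph. pair_graph F \<and> card (pverts F) = n \<and>
       (\<forall>v \<in> pverts F. out_degree (with_proj F) v \<le> d) \<longrightarrow>
       contains_subgraph (cayley_sum_graph (Z2_Zq_group t1 1 1) U) F)"
proof -
  define L where "L = ln (real n)"
  define Q where "Q t \<longleftrightarrow> 4 ^ (t * d) * L\<^sup>2 \<le> real n" for t :: nat
  have L: "1 \<le> L" using L1 by (simp add: L_def)
  have Q_bound: "real (t * d) \<le> L" if "Q t" for t
  proof -
    have "(4::real) ^ (t * d) * 1 \<le> 4 ^ (t * d) * L\<^sup>2"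
      using L by (intro mult_left_mono) auto
    also have "\<dots> \<le> real n" using that by (simp add: Q_def)
    finally have "ln ((4::real) ^ (t * d)) \<le> L"
      unfolding L_def using n by (subst ln_le_cancel_iff) auto
    then have "real (t * d) * ln 4 \<le> L" by (simp add: ln_realpow)
    moreover have "1 \<le> ln (4::real)"
      using exp_le by (subst ln_ge_iff) auto
    then have "real (t * d) * 1 \<le> real (t * d) * ln 4" by (intro mult_left_mono) auto
    ultimately show ?thesis by simp
  qed
  have "Q 0" using ln_squared_le_self[of "real n"] n by (simp add: Q_def L_def)
  moreover have "t \<le> nat \<lceil>L\<rceil>" if "Q t" for t
  proof -
    have "real t * 1 \<le> real t * real d" using d by (intro mult_left_mono) auto
    then have "real t \<le> L" using Q_bound[OF that] by simp
    then show ?thesis by linarith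
  qed
  ultimately obtain t where t: "Q t" "\<And>t'. Q t' \<Longrightarrow> t' \<le> t"
    using GreatestI_nat[of Q 0] Greatest_le_nat[of Q] by blast
  define M where "M = (4::real) ^ (t * d)"
  have M: "0 < M" "M * L\<^sup>2 \<le> real n" using t(1) by (auto simp: M_def Q_def)
  have nM: "L\<^sup>2 \<le> real n / M" using M by (simp add: field_simps)
  have td: "real t * real d \<le> L" using Q_bound[OF t(1)] by simp
  define K where "K = real n / M + 4 * real d * real (2 * t * d) * real t"
  \<comment> \<open>The error term is 8 times the square of \<open>t * d\<close>, and
    \<open>t * d \<le> L\<close> because \<open>ln 4\<close> is at least 1; so it costs at most 8
    times the average.\<close>
  have "4 * real d * real (2 * t * d) * real t = 8 * (real t * real d)\<^sup>2"
    by (simp add: power2_eq_square)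
  also have "\<dots> \<le> 8 * L\<^sup>2" using td by (intro mult_left_mono power_mono) auto
  also have "\<dots> \<le> 8 * (real n / M)" using nM by simp
  finally have K_le: "K \<le> 9 * (real n / M)" unfolding K_def by simp
  have "1 \<le> L\<^sup>2" using L by simp
  then have "1 \<le> real n / M" using nM by linarith
  then have K_ge: "1 \<le> K" unfolding K_def by (rule add_increasing2[rotated]) simp
  obtain k where "2 * K < 2 ^ k" using real_arch_pow[of 2 "2 * K"] by auto
  then have ex_l: "\<exists>k. 2 * K \<le> 2 ^ k" by (intro exI[of _ k]) simp
  \<comment> \<open>Minimality of \<open>l\<close> gives \<open>2^l <= 4 * K\<close>, hence at most
    36 times the average fibre size.\<close>
  define l where "l = (LEAST k. 2 * K \<le> 2 ^ k)"
  have l: "2 * K \<le> 2 ^ l" unfolding l_def by (rule LeastI_ex[OF ex_l])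
  have "0 < l" using l K_ge by (cases l) auto
  then have "\<not> 2 * K \<le> 2 ^ (l - 1)" unfolding l_def by (intro not_less_Least) (simp add: l_def)
  then have "2 * (2 ^ (l - 1)) \<le> 4 * K" by simp
  also have "2 * (2 ^ (l - 1)) = (2::real) ^ l" using \<open>0 < l\<close> by (cases l) auto
  finally have l_le: "2 ^ l \<le> 36 * (real n / M)" using K_le by simp
  define N where "N = 2 * t * d + l"
  obtain e where e: "bij_betw e (positions d t) {..<2 * t * d}"
    using ex_bij_betw_finite_nat[OF finite_positions, of d t] by (auto simp: lessThan_atLeast0)
  define U where "U = two_block_set e d t N"
  have U: "U \<subseteq> carrier (Z2_Zq_group N 1 1)" unfolding U_def by (rule two_block_set_subset)
  have t_le: "4 * t - 4 \<le> N"
  proof -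
    have "t * 2 \<le> t * d" using d by (intro mult_le_mono2) simp
    then show ?thesis unfolding N_def by linarith
  qed
  have "card U \<le> d\<^sup>2 * (t + 1)\<^sup>2 * 2 ^ (N - (4 * t - 4))"
    unfolding U_def
  proof (rule card_two_block_set_le)
    show "inj_on e (positions d t)" using e by (rule bij_betw_imp_inj_on)
    show "e ` positions d t \<subseteq> {..<N}" using bij_betw_imp_surj_on[OF e] by (auto simp: N_def)
  qed
  then have "real (card U) \<le> real (d\<^sup>2 * (t + 1)\<^sup>2 * 2 ^ (N - (4 * t - 4)))" by (rule of_nat_mono)
  also have "\<dots> = (real d)\<^sup>2 * (real t + 1)\<^sup>2 * 2 ^ (N - (4 * t - 4))" by simp
  \<comment> \<open>Here 9216 is 36 * 16 * 16: 36 from \<open>2^l\<close>, one 16 from the exempt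
    cells, one from passing from \<open>t + 1\<close> to \<open>t\<close>. The factor 4 in
    \<open>4 * L\<^sup>2\<close> completes 36864.\<close>
  also have "\<dots> \<le> (real d)\<^sup>2 * (4 * L\<^sup>2) * (9216 * (real n * (real n powr (- 2 / real d) * L powr (4 / real d))))"
  proof (intro mult_mono mult_left_mono)
    have "real t * 1 \<le> real t * real d" using d by (intro mult_left_mono) auto
    then have "real t + 1 \<le> 2 * L" using td L by linarith
    then have "(real t + 1)\<^sup>2 \<le> (2 * L)\<^sup>2" by (intro power_mono) auto
    then show "(real t + 1)\<^sup>2 \<le> 4 * L\<^sup>2" by (simp add: power_mult_distrib)
    have "(2::real) ^ (N - (4 * t - 4)) = 2 ^ N / 2 ^ (4 * t - 4)"
      using t_le by (simp add: power_diff)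
    also have "\<dots> \<le> 2 ^ N / (2 ^ (4 * t) / 16)"
    proof (rule divide_left_mono)
      have "(2::real) ^ (4 * t) \<le> 2 ^ ((4 * t - 4) + 4)" by (intro power_increasing) auto
      then show "(2::real) ^ (4 * t) / 16 \<le> 2 ^ (4 * t - 4)" by (simp only: power_add) simp
    qed auto
    also have "(2::real) ^ N = M * 2 ^ l"
      unfolding N_def M_def by (simp add: power_add mult.assoc power_mult)
    also have "M * 2 ^ l / (2 ^ (4 * t) / 16) \<le> M * (36 * (real n / M)) / (2 ^ (4 * t) / 16)"
      using l_le M(1) by (intro divide_right_mono mult_left_mono) auto
    also have "\<dots> = 576 * (real n * (1 / 16 ^ t))"
      using M(1) by (simp add: power_mult)
    also have "1 / 16 ^ t \<le> 16 * (real n powr (- 2 / real d) * L powr (4 / real d))"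
    proof -
      \<comment> \<open>The failure of \<open>Q\<close> at \<open>t + 1\<close>, raised to the power
        \<open>2 / d\<close>, turns \<open>4^((t+1)*d)\<close> into \<open>16^(t+1)\<close>.\<close>
      have "\<not> Q (Suc t)" using t(2)[of "Suc t"] by auto
      then have "real n \<le> 4 ^ (Suc t * d) * L\<^sup>2" by (simp add: Q_def)
      then have "real n powr (2 / real d) \<le> (4 ^ (Suc t * d) * L\<^sup>2) powr (2 / real d)"
        by (intro powr_mono2) auto
      also have "\<dots> = (4 ^ (Suc t * d)) powr (2 / real d) * (L\<^sup>2) powr (2 / real d)"
        using L by (simp add: powr_mult)
      also have "(4 ^ (Suc t * d)) powr (2 / real d) = (4::real) powr (real (2 * Suc t))"
        using d by (subst powr_realpow[symmetric]) (auto simp: powr_powr add_divide_distrib algebra_simps)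
      also have "\<dots> = 16 * 16 ^ t" by (subst powr_realpow) (auto simp: power_mult)
      also have "(L\<^sup>2) powr (2 / real d) = L powr (4 / real d)"
        using L powr_powr[of L 2 "2 / real d"] by simp
      finally have le: "real n powr (2 / real d) \<le> 16 * 16 ^ t * L powr (4 / real d)" .
      define A where "A = real n powr (2 / real d)"
      have "0 < A" using n by (simp add: A_def)
      have n_powr: "real n powr (- 2 / real d) = 1 / A"
        using powr_minus_divide[of "real n" "2 / real d"] by (simp add: A_def)
      show ?thesis unfolding n_powr using \<open>0 < A\<close> le[folded A_def] by (simp add: field_simps)
    qed
    finally show "2 ^ (N - (4 * t - 4)) \<le> 9216 * (real n * (real n powr (- 2 / real d) * L powr (4 / real d)))"
      by (simp add: mult_left_mono)
  qed auto
  also have "\<dots> = 36864 * (real n * real n powr (- 2 / real d)) * (real d)\<^sup>2 * (L\<^sup>2 * L powr (4 / real d))"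
    by simp
  also have "real n * real n powr (- 2 / real d) = real n powr (1 - 2 / real d)"
    using n powr_add[of "real n" 1 "- 2 / real d"] by simp
  also have "L\<^sup>2 * L powr (4 / real d) = L powr (2 + 4 / real d)"
    using L by (simp add: powr_add)
  finally have card_U: "real (card U) \<le> 36864 * real n powr (1 - 2 / real d) * (real d)\<^sup>2 * L powr (2 + 4 / real d)" .
  have "contains_subgraph (cayley_sum_graph (Z2_Zq_group N 1 1) U) F"
    if F: "pair_graph F" "card (pverts F) = n" "\<forall>v \<in> pverts F. out_degree (with_proj F) v \<le> d"
    for F :: "nat pair_pre_digraph"
  proof -
    interpret F: pair_graph F by fact
    interpret G: pair_sym_digraph "cayley_sum_graph (Z2_Zq_group N 1 1) U"
      by (intro pair_sym_digraph_cayley_sum_graph comm_group_Z2_Zq_group)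
    have "out_degree (with_proj F) v \<le> d" if "v \<in> pverts F" for v using F(3) that by blast
    note two_block_set_universal[OF e d F(1,2) this l[unfolded K_def M_def]]
    then obtain \<phi> where \<phi>: "inj_on \<phi> (pverts F)" "\<phi> ` pverts F \<subseteq> carrier (Z2_Zq_group N 1 1)"
      "\<forall>(u, v)\<in>parcs F. \<phi> u \<otimes>\<^bsub>Z2_Zq_group N 1 1\<^esub> \<phi> v \<in> U"
      unfolding N_def U_def by blast
    show ?thesis
      unfolding contains_subgraph_iff[OF G.pair_wf_digraph_axioms F.pair_wf_digraph_axioms]
      using \<phi> F.arc_fst_in_verts F.arc_snd_in_verts
      by (intro exI[of _ \<phi>]) (fastforce simp: cayley_sum_graph_def)
  qed
  moreover have "0 < N" using \<open>0 < l\<close> by (simp add: N_def)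
  ultimately show ?thesis using U card_U unfolding L_def by blast
qed

theorem theorem4p1:
  shows "\<exists>C::real. C > 0 \<and>
    (\<forall>d :: nat \<Rightarrow> nat.
      \<exists>(t1 :: nat \<Rightarrow> nat) (t2 :: nat \<Rightarrow> nat) (q :: nat \<Rightarrow> nat)
        (U :: nat \<Rightarrow> ((nat \<Rightarrow> int) \<times> (nat \<Rightarrow> int)) set).
      \<forall>n>0.
        t1 n > 0 \<and> t2 n > 0 \<and> q n > 0 \<and>
        U n \<subseteq> carrier (Z2_Zq_group (t1 n) (t2 n) (q n)) \<and>
        (3 \<le> d n \<and> real (d n) \<le> ln (real n) / ln (ln (real n)) \<longrightarrow>
          real (card (U n)) \<le> C * real n powr (1 - 2 / real (d n)) * (real (d n))\<^sup>2 *
            ln (real n) powr (2 + 4 / real (d n)) \<and>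
          (\<forall>F :: nat pair_pre_digraph.
            pair_graph F \<and> card (pverts F) = n \<and>
            (\<forall>v \<in> pverts F. out_degree (with_proj F) v \<le> d n) \<longrightarrow>
            contains_subgraph (cayley_sum_graph (Z2_Zq_group (t1 n) (t2 n) (q n)) (U n)) F)))"
proof (intro exI[of _ "36864::real"] conjI allI)
  fix d :: "nat \<Rightarrow> nat"
  define good where "good n t U \<longleftrightarrow>
      t > 0 \<and> U \<subseteq> carrier (Z2_Zq_group t 1 1) \<and>
      (3 \<le> d n \<and> real (d n) \<le> ln (real n) / ln (ln (real n)) \<longrightarrow>
        real (card U) \<le> 36864 * real n powr (1 - 2 / real (d n)) * (real (d n))\<^sup>2 *
          ln (real n) powr (2 + 4 / real (d n)) \<and>
        (\<forall>F :: nat pair_pre_digraph.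
          pair_graph F \<and> card (pverts F) = n \<and>
          (\<forall>v \<in> pverts F. out_degree (with_proj F) v \<le> d n) \<longrightarrow>
          contains_subgraph (cayley_sum_graph (Z2_Zq_group t 1 1) U) F))" for n t U
  have "\<exists>t U. n > 0 \<longrightarrow> good n t U" for n
  proof (cases "n > 0 \<and> 3 \<le> d n \<and> real (d n) \<le> ln (real n) / ln (ln (real n))")
    case True
    then have "1 \<le> ln (real n)" by (intro ln_ge_1_if_three_le_ratio) auto
    then show ?thesis
      using universal_generating_set_exists[of n "d n"] True unfolding good_def by blast
  next
    case False
    \<comment> \<open>Outside the admissible range the conditional claim is vacuous, so any positive
      parameters with an empty set do.\<close>
    then have "n > 0 \<longrightarrow> good n 1 {}" by (auto simp: good_def)
    then show ?thesis by blast
  qed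
  then obtain t U where tU: "\<And>n. n > 0 \<Longrightarrow> good n (t n) (U n)" by metis
  then show "\<exists>(t1 :: nat \<Rightarrow> nat) (t2 :: nat \<Rightarrow> nat) (q :: nat \<Rightarrow> nat)
        (U :: nat \<Rightarrow> ((nat \<Rightarrow> int) \<times> (nat \<Rightarrow> int)) set).
      \<forall>n>0.
        t1 n > 0 \<and> t2 n > 0 \<and> q n > 0 \<and>
        U n \<subseteq> carrier (Z2_Zq_group (t1 n) (t2 n) (q n)) \<and>
        (3 \<le> d n \<and> real (d n) \<le> ln (real n) / ln (ln (real n)) \<longrightarrow>
          real (card (U n)) \<le> 36864 * real n powr (1 - 2 / real (d n)) * (real (d n))\<^sup>2 *
            ln (real n) powr (2 + 4 / real (d n)) \<and>
          (\<forall>F :: nat pair_pre_digraph.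
            pair_graph F \<and> card (pverts F) = n \<and>
            (\<forall>v \<in> pverts F. out_degree (with_proj F) v \<le> d n) \<longrightarrow>
            contains_subgraph (cayley_sum_graph (Z2_Zq_group (t1 n) (t2 n) (q n)) (U n)) F))"
    unfolding good_def by (intro exI[of _ t] exI[of _ "\<lambda>_. 1"] exI[of _ U]) simp
qed simp

end
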